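(* Let $\Bbbk$, $A$, $f$, $A_f$ be as in the context and let $S$ be the direct sum of all the simple $A$-modules (one from each isomorphism class). Assume that $S$ satisfies condition $(\ast B)$, and identify $\operatorname{Ext}^*_{A_f}(S,S)$ with $\operatorname{Ext}^*_A(S,S)$ as in the context. Denote by $\circ$ and $\star$ the Yoneda products in $\operatorname{Ext}^*_{A_f}(S,S)$ and $\operatorname{Ext}^*_A(S,S)$ respectively. Then for $\hat g\in\operatorname{Ext}^p_{A_f}(S,S)$ and $\hat h\in\operatorname{Ext}^m_{A_f}(S,S)$, corresponding to $g\in \operatorname{Ext}^p_A(S,S)$ and $h\in\operatorname{Ext}^m_A(S,S)$, $$\hat h\circ\hat g=\begin{cases}0 & \text{if } m \text{ and } p \text{ are both odd},\\ h\star g & \text{in all other cases.}\end{cases}$$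
   Context: Setting. $\Bbbk$ is an algebraically closed field, $A$ a finite dimensional associative unital $\Bbbk$-algebra, all modules are finite dimensional left modules. $1=\sum_{i=1}^n e_i$ is a decomposition into primitive orthogonal idempotents such that $P_i=Ae_i$ ($1\le i\le n$) form a complete set of representatives of isomorphism classes of indecomposable projective $A$-modules; $S_i=P_i/\operatorname{rad}P_i$. $f\colon A\otimes_\Bbbk A\to A$ is a Hochschild $2$-cocycle: $af(b\otimes c)-f(ab\otimes c)+f(a\otimes bc)-f(a\otimes b)c=0$. $A_f=A[t]/(t^2)\simeq A\oplus A$ is the algebra with product $(a_0+a_1t)(b_0+b_1t)=a_0b_0+(a_0b_1+a_1b_0+f(a_0\otimes b_0))t$. $A_f$-modules. $\operatorname{mod}A_f$ is identified with the category of tuples $(M_0,M_1,T_M,f_M)$, $M_0,M_1\in\operatorname{mod}A$, $T_M\in\operatorname{Hom}_A(M_0,M_1)$ a monomorphism, $f_M\in\operatorname{Hom}_\Bbbk(A\otimes_\Bbbk M_0,M_1)$ with $af_M(b\otimes m)-f_M(ab\otimes m)+f_M(a\otimes bm)-f(a\otimes b)T_M(m)=0$; the tuple corresponds to $M_0\oplus M_1$ with $(a+bt)(m_0,m_1)=(am_0,\,am_1+bT_M(m_0)+f_M(a\otimes m_0))$. Morphisms $(M_0,M_1,T_M,f_M)\to(N_0,N_1,T_N,f_N)$ are triples $(u_0,u_1,u_2)$, $u_0\in\operatorname{Hom}_A(M_0,N_0)$, $u_2\in\operatorname{Hom}_A(M_1,N_1)$, $u_1\in\operatorname{Hom}_\Bbbk(M_0,N_1)$,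 with $T_Nu_0=u_2T_M$ and $u_1(am)=au_1(m)-u_2(f_M(a\otimes m))+f_N(a\otimes u_0(m))$; composition is $(v_0,v_1,v_2)(u_0,u_1,u_2)=(v_0u_0,\,v_2u_1+v_1u_0,\,v_2u_2)$. An $A$-module $M$ is viewed as the $A_f$-module $(0,M,0,0)$. Projectives. Every projective $A$-module $Q$ is taken with a decomposition $Q=\bigoplus_{r=1}^m Ae_{i_r}$; for $x=\sum x_r\in Q$, $x_r\in Ae_{i_r}$, write $[x]=[x_1\cdots x_m]$; $E\in M_m(A)$ is the diagonal matrix with entries $e_{i_1},\dots,e_{i_m}$. $f_Q\colon A\otimes Q\to Q$ is $f_Q(a\otimes x)=\sum_r f(a\otimes x_r)e_{i_r}$, and $\hat Q=(Q,Q,\mathrm{Id},f_Q)$, a projective $A_f$-module. A morphism $\delta\colon Q\to Q'$ of projective $A$-modules is given by a matrix $B$ with $EBE'=B$ via $[\delta(x)]=[x]B$. For matrices over $A$ of compatible sizes, $\tilde f(B\otimes B')_{ij}=\sum_l f(b_{il}\otimes b'_{lj})$. Condition $(\ast B)$. An $A$-module $M$ satisfies $(\ast B)$ if it has a minimal projective resolution $\cdots\to Q_1\xrightarrow{\delta_1}Q_0\xrightarrow{\delta_0}M\to0$ such that, with $B_{i+1}$ the matrix of $\delta_{i+1}\colon Q_{i+1}\to Q_i$, $E_i$ the diagonal matrix of $Q_i$, and $T_{\delta_{i+1}}\colon Q_{i+1}\to Q_i$ the linear map $[T_{\delta_{i+1}}(x)]=\tilde f([x]\otimes B_{i+1})E_i$,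 for every $i\ge0$: (i) $\delta_{2i}T_{\delta_{2i+1}}$ restricted to $\operatorname{Ker}\delta_{2i+1}$ is injective; (ii) $Q_{2i}=T_{\delta_{2i+1}}(\operatorname{Ker}\delta_{2i+1})\oplus\operatorname{Im}\delta_{2i+1}$ as $\Bbbk$-vector spaces. Resolution and identification (for $M=S$). A minimal projective resolution of the $A_f$-module $S$ is $\cdots\to\hat Q_m\xrightarrow{\hat\delta_m}\hat Q_{m-1}\to\cdots\to\hat Q_0\xrightarrow{\hat\delta_0}S\to0$ with $\hat\delta_{2i}=(0,\delta_{2i},0)$ and $\hat\delta_{2i+1}=(\delta_{2i+1},T_{\delta_{2i+1}},\delta_{2i+1})$. By minimality, $\operatorname{Ext}^p_A(S,S)=\operatorname{Hom}_A(Q_p,S)$ and $\operatorname{Ext}^p_{A_f}(S,S)=\operatorname{Hom}_{A_f}(\hat Q_p,S)$; each element of the latter has the form $\hat g=(0,g,0)$ with $g\in\operatorname{Hom}_A(Q_p,S)$, and $\hat g$ is identified with $g$. Yoneda product: for classes $h$ of degree $m$ and $g$ of degree $p$, the product of $h$ and $g$ (in this order) is the class of $h\gamma_m$, where $\{\gamma_j\}_{j\ge0}$ is a lifting of $g$ to a chain map between the chosen projective resolutions ($\gamma_j$ from degree $p+j$ to degree $j$), strictly commuting with the differentials. *)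

theory Defs
  imports
    "HOL-Computational_Algebra.Polynomial"
    "HOL-Library.Function_Algebras"
    "HOL-Library.Product_Plus"
begin

section \<open>Left modules over a not necessarily commutative ring\<close>

text \<open>
  A ring is given by a multiplication and a unit on a type of class \<open>ab_group_add\<close>; this is
  flexible enough for both \<open>A\<close> and \<open>A\<^sub>f\<close>, whose multiplication depends on the parameter \<open>f\<close>.
  A module is a carrier set in a type of class \<open>ab_group_add\<close>, with an action.
\<close>

record ('r, 'm) lmod =
  carr :: "'m set"
  act :: "'r \<Rightarrow> 'm \<Rightarrow> 'm"

definition left_module ::
  "('r::ab_group_add \<Rightarrow> 'r \<Rightarrow> 'r) \<Rightarrow> 'r \<Rightarrow> ('r, 'm::ab_group_add) lmod \<Rightarrow> bool" where
  "left_module mul u M \<longleftrightarrow>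
     0 \<in> carr M \<and> (\<forall>x\<in>carr M. \<forall>y\<in>carr M. x - y \<in> carr M) \<and>
     (\<forall>a. \<forall>x\<in>carr M. act M a x \<in> carr M) \<and>
     (\<forall>a. \<forall>x\<in>carr M. \<forall>y\<in>carr M. act M a (x + y) = act M a x + act M a y) \<and>
     (\<forall>a b. \<forall>x\<in>carr M. act M (a + b) x = act M a x + act M b x) \<and>
     (\<forall>a b. \<forall>x\<in>carr M. act M (mul a b) x = act M a (act M b x)) \<and>
     (\<forall>x\<in>carr M. act M u x = x)"

text \<open>
  Maps between carriers are represented by functions on the whole type that vanish outside the
  carrier of the source. Equality of maps is then equality of functions, composition is
  \<open>(\<circ>)\<close>, and a set of homomorphisms is closed under pointwise addition.
\<close>

definition zext :: "'m set \<Rightarrow> ('m \<Rightarrow> 'n::zero) \<Rightarrow> 'm \<Rightarrow> 'n" where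
  "zext X u = (\<lambda>x. if x \<in> X then u x else 0)"

definition Hom ::
  "('r, 'm::ab_group_add) lmod \<Rightarrow> ('r, 'n::ab_group_add) lmod \<Rightarrow> ('m \<Rightarrow> 'n) set" where
  "Hom M N = {u. (\<forall>x\<in>carr M. u x \<in> carr N) \<and>
                 (\<forall>x\<in>carr M. \<forall>y\<in>carr M. u (x + y) = u x + u y) \<and>
                 (\<forall>a. \<forall>x\<in>carr M. u (act M a x) = act N a (u x)) \<and>
                 (\<forall>x. x \<notin> carr M \<longrightarrow> u x = 0)}"

definition ker_on :: "('r, 'm) lmod \<Rightarrow> ('m \<Rightarrow> 'n::zero) \<Rightarrow> 'm set" where
  "ker_on M u = {x \<in> carr M. u x = 0}"

definition mod_iso :: "('r, 'm::ab_group_add) lmod \<Rightarrow> ('r, 'n::ab_group_add) lmod \<Rightarrow> bool" where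
  "mod_iso M N \<longleftrightarrow> (\<exists>u\<in>Hom M N. bij_betw u (carr M) (carr N))"

definition submodule :: "'m::ab_group_add set \<Rightarrow> ('r, 'm) lmod \<Rightarrow> bool" where
  "submodule N M \<longleftrightarrow> N \<subseteq> carr M \<and> 0 \<in> N \<and> (\<forall>x\<in>N. \<forall>y\<in>N. x - y \<in> N) \<and>
     (\<forall>a. \<forall>x\<in>N. act M a x \<in> N)"

definition maximal_submodule :: "'m::ab_group_add set \<Rightarrow> ('r, 'm) lmod \<Rightarrow> bool" where
  "maximal_submodule N M \<longleftrightarrow> submodule N M \<and> N \<noteq> carr M \<and>
     (\<forall>N'. submodule N' M \<and> N \<subseteq> N' \<longrightarrow> N' = N \<or> N' = carr M)"

definition rad :: "('r, 'm::ab_group_add) lmod \<Rightarrow> 'm set" where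
  "rad M = {x \<in> carr M. \<forall>N. maximal_submodule N M \<longrightarrow> x \<in> N}"

definition superfluous :: "'m::ab_group_add set \<Rightarrow> ('r, 'm) lmod \<Rightarrow> bool" where
  "superfluous K M \<longleftrightarrow>
     (\<forall>N. submodule N M \<and> {x + y | x y. x \<in> K \<and> y \<in> N} = carr M \<longrightarrow> N = carr M)"

definition direct_decomp :: "'m::ab_group_add set \<Rightarrow> 'm set \<Rightarrow> 'm set \<Rightarrow> bool" where
  "direct_decomp X U V \<longleftrightarrow> X = {x + y | x y. x \<in> U \<and> y \<in> V} \<and> U \<inter> V = {0}"

definition indecomposable :: "('r, 'm::ab_group_add) lmod \<Rightarrow> bool" where
  "indecomposable M \<longleftrightarrow> carr M \<noteq> {0} \<and>
     (\<forall>U V. submodule U M \<and> submodule V M \<and> direct_decomp (carr M) U V \<longrightarrow> U = {0} \<or> V = {0})"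

text \<open>\<open>L \<cong> M / K\<close>, expressed by a surjection \<open>M \<rightarrow> L\<close> with kernel \<open>K\<close>.\<close>

definition is_quotient ::
  "('r, 'l::ab_group_add) lmod \<Rightarrow> ('r, 'm::ab_group_add) lmod \<Rightarrow> 'm set \<Rightarrow> bool" where
  "is_quotient L M K \<longleftrightarrow> (\<exists>\<pi>\<in>Hom M L. \<pi> ` carr M = carr L \<and> ker_on M \<pi> = K)"


section \<open>Ext and Yoneda products computed with a given resolution\<close>

text \<open>
  The resolution \<open>\<dots> \<rightarrow> R\<^sub>1 \<rightarrow> R\<^sub>0 \<rightarrow> M \<rightarrow> 0\<close>; the map \<open>R\<^sub>i \<rightarrow> R\<^sub>i\<^sub>-\<^sub>1\<close> is \<open>bd R i\<close> for \<open>i \<ge> 1\<close>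
  (the value \<open>bd R 0\<close> is never used) and \<open>aug R\<close> is \<open>R\<^sub>0 \<rightarrow> M\<close>.
\<close>

record ('r, 'm, 's) resolution =
  obj :: "nat \<Rightarrow> ('r, 'm) lmod"
  bd :: "nat \<Rightarrow> 'm \<Rightarrow> 'm"
  aug :: "'m \<Rightarrow> 's"

definition Ext_cocycles ::
  "('r, 'm::ab_group_add, 's) resolution \<Rightarrow> ('r, 'n::ab_group_add) lmod \<Rightarrow> nat \<Rightarrow> ('m \<Rightarrow> 'n) set" where
  "Ext_cocycles R N p = {g \<in> Hom (obj R p) N. g \<circ> bd R (Suc p) = 0}"

definition Ext_coboundaries ::
  "('r, 'm::ab_group_add, 's) resolution \<Rightarrow> ('r, 'n::ab_group_add) lmod \<Rightarrow> nat \<Rightarrow> ('m \<Rightarrow> 'n) set" where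
  "Ext_coboundaries R N p =
     (case p of 0 \<Rightarrow> {0} | Suc j \<Rightarrow> {u \<circ> bd R (Suc j) | u. u \<in> Hom (obj R j) N})"

definition Ext_class ::
  "('r, 'm::ab_group_add, 's) resolution \<Rightarrow> ('r, 'n::ab_group_add) lmod \<Rightarrow> nat \<Rightarrow>
     ('m \<Rightarrow> 'n) \<Rightarrow> ('m \<Rightarrow> 'n) set" where
  "Ext_class R N p g = {g + b | b. b \<in> Ext_coboundaries R N p}"

definition Ext ::
  "('r, 'm::ab_group_add, 's) resolution \<Rightarrow> ('r, 'n::ab_group_add) lmod \<Rightarrow> nat \<Rightarrow> ('m \<Rightarrow> 'n) set set" where
  "Ext R N p = Ext_class R N p ` Ext_cocycles R N p"

text \<open>\<open>\<gamma>\<close> lifts \<open>g : R\<^sub>p \<rightarrow> M\<close> to a chain map; the squares commute strictly (no signs).\<close>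

definition lifting ::
  "('r, 'm::ab_group_add, 's) resolution \<Rightarrow> nat \<Rightarrow> ('m \<Rightarrow> 's) \<Rightarrow> (nat \<Rightarrow> 'm \<Rightarrow> 'm) \<Rightarrow> bool" where
  "lifting R p g \<gamma> \<longleftrightarrow>
     (\<forall>j. \<gamma> j \<in> Hom (obj R (p + j)) (obj R j)) \<and>
     aug R \<circ> \<gamma> 0 = g \<and>
     (\<forall>j. bd R (Suc j) \<circ> \<gamma> (Suc j) = \<gamma> j \<circ> bd R (p + Suc j))"

text \<open>
  The product of \<open>H \<in> Ext\<^sup>m(M, N)\<close> and \<open>G \<in> Ext\<^sup>p(M, M)\<close>, in this order; \<open>R\<close> resolves \<open>M\<close>.
\<close>

definition yoneda ::
  "('r, 'm::ab_group_add, 's) resolution \<Rightarrow> ('r, 'n::ab_group_add) lmod \<Rightarrow> nat \<Rightarrow> nat \<Rightarrow>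
     ('m \<Rightarrow> 'n) set \<Rightarrow> ('m \<Rightarrow> 's) set \<Rightarrow> ('m \<Rightarrow> 'n) set" where
  "yoneda R N m p H G =
     (THE Z. \<exists>h\<in>H. \<exists>g\<in>G. \<exists>\<gamma>. lifting R p g \<gamma> \<and> Z = Ext_class R N (m + p) (h \<circ> \<gamma> m))"


section \<open>The algebra \<open>A\<close>, its projectives and its simples\<close>

definition fd_algebra :: "('k::field \<Rightarrow> 'a::ring_1 \<Rightarrow> 'a) \<Rightarrow> bool" where
  "fd_algebra scale \<longleftrightarrow>
     (\<exists>Basis. finite_dimensional_vector_space scale Basis) \<and>
     (\<forall>c a b. scale c (a * b) = scale c a * b \<and> scale c (a * b) = a * scale c b)"

text \<open>A linear map \<open>A \<otimes> A \<rightarrow> A\<close> is given as a bilinear map.\<close>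

definition hochschild_2cocycle :: "('k::field \<Rightarrow> 'a::ring_1 \<Rightarrow> 'a) \<Rightarrow> ('a \<Rightarrow> 'a \<Rightarrow> 'a) \<Rightarrow> bool" where
  "hochschild_2cocycle scale f \<longleftrightarrow>
     (\<forall>a. Vector_Spaces.linear scale scale (f a)) \<and>
     (\<forall>b. Vector_Spaces.linear scale scale (\<lambda>a. f a b)) \<and>
     (\<forall>a b c. a * f b c - f (a * b) c + f a (b * c) - f a b * c = 0)"

definition primitive_idempotent :: "'a::ring_1 \<Rightarrow> bool" where
  "primitive_idempotent x \<longleftrightarrow> x \<noteq> 0 \<and> x * x = x \<and>
     (\<forall>u v. u * u = u \<and> v * v = v \<and> u * v = 0 \<and> v * u = 0 \<and> x = u + v \<longrightarrow> u = 0 \<or> v = 0)"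

definition P :: "'a::ring_1 \<Rightarrow> ('a, 'a) lmod" where
  "P x = \<lparr>carr = range (\<lambda>a. a * x), act = (*)\<rparr>"

definition free_mod :: "nat \<Rightarrow> ('a::ring_1, nat \<Rightarrow> 'a) lmod" where
  "free_mod m = \<lparr>carr = {x. \<forall>r\<ge>m. x r = 0}, act = (\<lambda>a x r. a * x r)\<rparr>"

definition fg_projective :: "('a::ring_1, 'm::ab_group_add) lmod \<Rightarrow> bool" where
  "fg_projective M \<longleftrightarrow> left_module (*) 1 M \<and>
     (\<exists>m. \<exists>s\<in>Hom M (free_mod m). \<exists>r\<in>Hom (free_mod m) M. \<forall>x\<in>carr M. r (s x) = x)"

text \<open>
  In the completeness clause it suffices to let \<open>M\<close> range over modules with elements of type
  \<open>nat \<Rightarrow> 'a\<close>: every finitely generated projective module is isomorphic to one of these.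
\<close>

definition basic_idempotents :: "nat \<Rightarrow> (nat \<Rightarrow> 'a::ring_1) \<Rightarrow> bool" where
  "basic_idempotents n e \<longleftrightarrow>
     (\<Sum>i<n. e i) = 1 \<and>
     (\<forall>i<n. primitive_idempotent (e i)) \<and>
     (\<forall>i<n. \<forall>j<n. i \<noteq> j \<longrightarrow> e i * e j = 0) \<and>
     (\<forall>i<n. \<forall>j<n. i \<noteq> j \<longrightarrow> \<not> mod_iso (P (e i)) (P (e j))) \<and>
     (\<forall>M :: ('a, nat \<Rightarrow> 'a) lmod. fg_projective M \<and> indecomposable M \<longrightarrow>
        (\<exists>i<n. mod_iso M (P (e i))))"

text \<open>\<open>S\<close> is the (internal) direct sum of copies of the \<open>P\<^sub>i / rad P\<^sub>i\<close>, one for each \<open>i\<close>.\<close>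

definition sum_of_simples ::
  "nat \<Rightarrow> (nat \<Rightarrow> 'a::ring_1) \<Rightarrow> ('a, 's::ab_group_add) lmod \<Rightarrow> bool" where
  "sum_of_simples n e S \<longleftrightarrow> left_module (*) 1 S \<and>
     (\<exists>L. (\<forall>i<n. submodule (L i) S \<and>
                  is_quotient \<lparr>carr = L i, act = act S\<rparr> (P (e i)) (rad (P (e i)))) \<and>
          (\<forall>x\<in>carr S. \<exists>!y. (\<forall>i<n. y i \<in> L i) \<and> (\<forall>i\<ge>n. y i = 0) \<and> x = (\<Sum>i<n. y i)))"

text \<open>
  A list \<open>js = [i\<^sub>1, \<dots>, i\<^sub>m]\<close> of indices stands for the projective module \<open>Ae\<^sub>i\<^sub>1 \<oplus> \<dots> \<oplus> Ae\<^sub>i\<^sub>m\<close>. Its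
  elements are the row vectors \<open>[x]\<close>, written as functions on \<open>nat\<close> that vanish from \<open>m\<close> on.
  Likewise, only the entries \<open>B r s\<close> with \<open>r\<close>, \<open>s\<close> below the relevant lengths matter in a
  matrix \<open>B\<close>.
\<close>

definition Qmod :: "(nat \<Rightarrow> 'a::ring_1) \<Rightarrow> nat list \<Rightarrow> ('a, nat \<Rightarrow> 'a) lmod" where
  "Qmod e js = \<lparr>carr = {x. (\<forall>r<length js. x r \<in> carr (P (e (js ! r)))) \<and> (\<forall>r\<ge>length js. x r = 0)},
                act = (\<lambda>a x r. a * x r)\<rparr>"

text \<open>\<open>E B E' = B\<close> for the diagonal matrices \<open>E\<close> of \<open>js\<close> and \<open>E'\<close> of \<open>js'\<close>.\<close>

definition is_hom_matrix ::
  "(nat \<Rightarrow> 'a::ring_1) \<Rightarrow> nat list \<Rightarrow> nat list \<Rightarrow> (nat \<Rightarrow> nat \<Rightarrow> 'a) \<Rightarrow> bool" where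
  "is_hom_matrix e js js' B \<longleftrightarrow>
     (\<forall>r<length js. \<forall>s<length js'. e (js ! r) * B r s * e (js' ! s) = B r s)"

text \<open>\<open>[\<delta>(x)] = [x] B\<close>, a map from the module of \<open>js\<close> to that of \<open>js'\<close>.\<close>

definition hom_of_matrix ::
  "(nat \<Rightarrow> 'a::ring_1) \<Rightarrow> nat list \<Rightarrow> nat list \<Rightarrow> (nat \<Rightarrow> nat \<Rightarrow> 'a) \<Rightarrow> (nat \<Rightarrow> 'a) \<Rightarrow> nat \<Rightarrow> 'a" where
  "hom_of_matrix e js js' B = zext (carr (Qmod e js))
     (\<lambda>x s. if s < length js' then (\<Sum>l<length js. x l * B l s) else 0)"

text \<open>\<open>[T(x)] = f~([x] \<otimes> B) E'\<close>.\<close>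

definition T_of_matrix ::
  "('a::ring_1 \<Rightarrow> 'a \<Rightarrow> 'a) \<Rightarrow> (nat \<Rightarrow> 'a) \<Rightarrow> nat list \<Rightarrow> nat list \<Rightarrow> (nat \<Rightarrow> nat \<Rightarrow> 'a) \<Rightarrow>
     (nat \<Rightarrow> 'a) \<Rightarrow> nat \<Rightarrow> 'a" where
  "T_of_matrix f e js js' B = zext (carr (Qmod e js))
     (\<lambda>x s. if s < length js' then (\<Sum>l<length js. f (x l) (B l s)) * e (js' ! s) else 0)"

definition f_Q :: "('a::ring_1 \<Rightarrow> 'a \<Rightarrow> 'a) \<Rightarrow> (nat \<Rightarrow> 'a) \<Rightarrow> nat list \<Rightarrow> 'a \<Rightarrow> (nat \<Rightarrow> 'a) \<Rightarrow> nat \<Rightarrow> 'a" where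
  "f_Q f e js a x = (\<lambda>r. if r < length js then f a (x r) * e (js ! r) else 0)"


section \<open>Minimal projective resolutions over \<open>A\<close> and the condition (*B)\<close>

text \<open>
  A resolution \<open>\<dots> \<rightarrow> Q\<^sub>1 \<rightarrow> Q\<^sub>0 \<rightarrow> M \<rightarrow> 0\<close> is given by index lists \<open>q i\<close> for the \<open>Q\<^sub>i\<close>, matrices
  \<open>B (Suc i)\<close> of \<open>\<delta>\<^sub>i\<^sub>+\<^sub>1\<close>, and \<open>\<epsilon> = \<delta>\<^sub>0\<close>.
\<close>

definition \<delta> :: "(nat \<Rightarrow> 'a::ring_1) \<Rightarrow> (nat \<Rightarrow> nat list) \<Rightarrow> (nat \<Rightarrow> nat \<Rightarrow> nat \<Rightarrow> 'a) \<Rightarrow>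
    nat \<Rightarrow> (nat \<Rightarrow> 'a) \<Rightarrow> nat \<Rightarrow> 'a" where
  "\<delta> e q B i = hom_of_matrix e (q i) (q (i - 1)) (B i)"

definition T\<delta> :: "('a::ring_1 \<Rightarrow> 'a \<Rightarrow> 'a) \<Rightarrow> (nat \<Rightarrow> 'a) \<Rightarrow> (nat \<Rightarrow> nat list) \<Rightarrow>
    (nat \<Rightarrow> nat \<Rightarrow> nat \<Rightarrow> 'a) \<Rightarrow> nat \<Rightarrow> (nat \<Rightarrow> 'a) \<Rightarrow> nat \<Rightarrow> 'a" where
  "T\<delta> f e q B i = T_of_matrix f e (q i) (q (i - 1)) (B i)"

definition res_A :: "(nat \<Rightarrow> 'a::ring_1) \<Rightarrow> (nat \<Rightarrow> nat list) \<Rightarrow> (nat \<Rightarrow> nat \<Rightarrow> nat \<Rightarrow> 'a) \<Rightarrow>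
    ((nat \<Rightarrow> 'a) \<Rightarrow> 's) \<Rightarrow> ('a, nat \<Rightarrow> 'a, 's) resolution" where
  "res_A e q B \<epsilon> = \<lparr>obj = (\<lambda>i. Qmod e (q i)), bd = \<delta> e q B, aug = \<epsilon>\<rparr>"

definition minimal_projective_resolution ::
  "nat \<Rightarrow> (nat \<Rightarrow> 'a::ring_1) \<Rightarrow> ('a, 's::ab_group_add) lmod \<Rightarrow> (nat \<Rightarrow> nat list) \<Rightarrow>
     (nat \<Rightarrow> nat \<Rightarrow> nat \<Rightarrow> 'a) \<Rightarrow> ((nat \<Rightarrow> 'a) \<Rightarrow> 's) \<Rightarrow> bool" where
  "minimal_projective_resolution n e M q B \<epsilon> \<longleftrightarrow>
     (\<forall>i. set (q i) \<subseteq> {..<n}) \<and>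
     (\<forall>i. is_hom_matrix e (q (Suc i)) (q i) (B (Suc i))) \<and>
     \<epsilon> \<in> Hom (Qmod e (q 0)) M \<and>
     \<epsilon> ` carr (Qmod e (q 0)) = carr M \<and>
     ker_on (Qmod e (q 0)) \<epsilon> = \<delta> e q B 1 ` carr (Qmod e (q 1)) \<and>
     (\<forall>i\<ge>1. ker_on (Qmod e (q i)) (\<delta> e q B i) =
              \<delta> e q B (Suc i) ` carr (Qmod e (q (Suc i)))) \<and>
     superfluous (ker_on (Qmod e (q 0)) \<epsilon>) (Qmod e (q 0)) \<and>
     (\<forall>i\<ge>1. superfluous (ker_on (Qmod e (q i)) (\<delta> e q B i)) (Qmod e (q i)))"

text \<open>
  The minimal projective resolution \<open>(q, B, \<epsilon>)\<close> of \<open>M\<close> witnesses (*B). The case \<open>i = 0\<close> of (i)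
  is separate because \<open>\<delta>\<^sub>0 = \<epsilon>\<close> has another codomain.
\<close>

definition star_B_resolution ::
  "('a::ring_1 \<Rightarrow> 'a \<Rightarrow> 'a) \<Rightarrow> nat \<Rightarrow> (nat \<Rightarrow> 'a) \<Rightarrow> ('a, 's::ab_group_add) lmod \<Rightarrow>
     (nat \<Rightarrow> nat list) \<Rightarrow> (nat \<Rightarrow> nat \<Rightarrow> nat \<Rightarrow> 'a) \<Rightarrow> ((nat \<Rightarrow> 'a) \<Rightarrow> 's) \<Rightarrow> bool" where
  "star_B_resolution f n e M q B \<epsilon> \<longleftrightarrow>
     minimal_projective_resolution n e M q B \<epsilon> \<and>
     inj_on (\<epsilon> \<circ> T\<delta> f e q B 1) (ker_on (Qmod e (q 1)) (\<delta> e q B 1)) \<and>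
     (\<forall>i\<ge>1. inj_on (\<delta> e q B (2*i) \<circ> T\<delta> f e q B (2*i+1))
                    (ker_on (Qmod e (q (2*i+1))) (\<delta> e q B (2*i+1)))) \<and>
     (\<forall>i. direct_decomp (carr (Qmod e (q (2*i))))
            (T\<delta> f e q B (2*i+1) ` ker_on (Qmod e (q (2*i+1))) (\<delta> e q B (2*i+1)))
            (\<delta> e q B (2*i+1) ` carr (Qmod e (q (2*i+1)))))"


section \<open>The algebra \<open>A\<^sub>f\<close> and its modules\<close>

text \<open>The pair \<open>(a\<^sub>0, a\<^sub>1)\<close> stands for \<open>a\<^sub>0 + a\<^sub>1 t\<close>.\<close>

definition Af_mult :: "('a::ring_1 \<Rightarrow> 'a \<Rightarrow> 'a) \<Rightarrow> 'a \<times> 'a \<Rightarrow> 'a \<times> 'a \<Rightarrow> 'a \<times> 'a" where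
  "Af_mult f = (\<lambda>(a0, a1) (b0, b1). (a0 * b0, a0 * b1 + a1 * b0 + f a0 b0))"

definition Af_one :: "('a::ring_1 \<Rightarrow> 'a \<Rightarrow> 'a) \<Rightarrow> 'a \<times> 'a" where
  "Af_one f = (1, - f 1 1)"

text \<open>The \<open>A\<^sub>f\<close>-module on \<open>M\<^sub>0 \<oplus> M\<^sub>1\<close> given by a tuple \<open>(M\<^sub>0, M\<^sub>1, T\<^sub>M, f\<^sub>M)\<close>.\<close>

definition tuple_mod ::
  "('a, 'm0) lmod \<Rightarrow> ('a, 'm1::ab_group_add) lmod \<Rightarrow> ('m0 \<Rightarrow> 'm1) \<Rightarrow> ('a \<Rightarrow> 'm0 \<Rightarrow> 'm1) \<Rightarrow>
     ('a \<times> 'a, 'm0 \<times> 'm1) lmod" where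
  "tuple_mod M0 M1 T fM =
     \<lparr>carr = carr M0 \<times> carr M1,
      act = (\<lambda>(a, b) (m0, m1). (act M0 a m0, act M1 a m1 + act M1 b (T m0) + fM a m0))\<rparr>"

text \<open>The map \<open>M\<^sub>0 \<oplus> M\<^sub>1 \<rightarrow> N\<^sub>0 \<oplus> N\<^sub>1\<close> given by a triple \<open>(u\<^sub>0, u\<^sub>1, u\<^sub>2)\<close>.\<close>

definition triple_map ::
  "('r, 'm0 \<times> 'm1) lmod \<Rightarrow> ('m0 \<Rightarrow> 'n0::zero) \<Rightarrow> ('m0 \<Rightarrow> 'n1::ab_group_add) \<Rightarrow> ('m1 \<Rightarrow> 'n1) \<Rightarrow>
     'm0 \<times> 'm1 \<Rightarrow> 'n0 \<times> 'n1" where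
  "triple_map M u0 u1 u2 = zext (carr M) (\<lambda>(m0, m1). (u0 m0, u1 m0 + u2 m1))"

definition zero_mod :: "('r, 'm::zero) lmod" where
  "zero_mod = \<lparr>carr = {0}, act = (\<lambda>_ _. 0)\<rparr>"

definition as_Af_mod :: "('a, 's::ab_group_add) lmod \<Rightarrow> ('a \<times> 'a, 's \<times> 's) lmod" where
  "as_Af_mod M = tuple_mod zero_mod M (\<lambda>_. 0) (\<lambda>_ _. 0)"

definition Qhat :: "('a::ring_1 \<Rightarrow> 'a \<Rightarrow> 'a) \<Rightarrow> (nat \<Rightarrow> 'a) \<Rightarrow> nat list \<Rightarrow>
    ('a \<times> 'a, (nat \<Rightarrow> 'a) \<times> (nat \<Rightarrow> 'a)) lmod" where
  "Qhat f e js = tuple_mod (Qmod e js) (Qmod e js) (\<lambda>x. x) (f_Q f e js)"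

definition \<delta>hat :: "('a::ring_1 \<Rightarrow> 'a \<Rightarrow> 'a) \<Rightarrow> (nat \<Rightarrow> 'a) \<Rightarrow> (nat \<Rightarrow> nat list) \<Rightarrow>
    (nat \<Rightarrow> nat \<Rightarrow> nat \<Rightarrow> 'a) \<Rightarrow> nat \<Rightarrow> (nat \<Rightarrow> 'a) \<times> (nat \<Rightarrow> 'a) \<Rightarrow> (nat \<Rightarrow> 'a) \<times> (nat \<Rightarrow> 'a)" where
  "\<delta>hat f e q B i =
     (if even i then triple_map (Qhat f e (q i)) (\<lambda>_. 0) (\<delta> e q B i) (\<lambda>_. 0)
      else triple_map (Qhat f e (q i)) (\<delta> e q B i) (T\<delta> f e q B i) (\<delta> e q B i))"

text \<open>For \<open>g : Q\<^sub>p \<rightarrow> S\<close>, the map \<open>(0, g, 0)\<close> from the lifted projective to \<open>(0, S, 0, 0)\<close>.\<close>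

definition hat :: "('a::ring_1 \<Rightarrow> 'a \<Rightarrow> 'a) \<Rightarrow> (nat \<Rightarrow> 'a) \<Rightarrow> nat list \<Rightarrow> ((nat \<Rightarrow> 'a) \<Rightarrow> 's::ab_group_add) \<Rightarrow>
    (nat \<Rightarrow> 'a) \<times> (nat \<Rightarrow> 'a) \<Rightarrow> 's \<times> 's" where
  "hat f e js g = triple_map (Qhat f e js) (\<lambda>_. 0) g (\<lambda>_. 0)"

definition res_Af :: "('a::ring_1 \<Rightarrow> 'a \<Rightarrow> 'a) \<Rightarrow> (nat \<Rightarrow> 'a) \<Rightarrow> (nat \<Rightarrow> nat list) \<Rightarrow>
    (nat \<Rightarrow> nat \<Rightarrow> nat \<Rightarrow> 'a) \<Rightarrow> ((nat \<Rightarrow> 'a) \<Rightarrow> 's::ab_group_add) \<Rightarrow>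
    ('a \<times> 'a, (nat \<Rightarrow> 'a) \<times> (nat \<Rightarrow> 'a), 's \<times> 's) resolution" where
  "res_Af f e q B \<epsilon> =
     \<lparr>obj = (\<lambda>i. Qhat f e (q i)), bd = \<delta>hat f e q B, aug = hat f e (q 0) \<epsilon>\<rparr>"

text \<open>The identification of \<open>Ext\<^sub>A\<^sup>p(S, S)\<close> with \<open>Ext\<^sup>p(S, S)\<close> over \<open>A\<^sub>f\<close>.\<close>

definition ident :: "('a::ring_1 \<Rightarrow> 'a \<Rightarrow> 'a) \<Rightarrow> (nat \<Rightarrow> 'a) \<Rightarrow> ('a, 's::ab_group_add) lmod \<Rightarrow>
    (nat \<Rightarrow> nat list) \<Rightarrow> (nat \<Rightarrow> nat \<Rightarrow> nat \<Rightarrow> 'a) \<Rightarrow> ((nat \<Rightarrow> 'a) \<Rightarrow> 's) \<Rightarrow> nat \<Rightarrow>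
    ((nat \<Rightarrow> 'a) \<Rightarrow> 's) set \<Rightarrow> ((nat \<Rightarrow> 'a) \<times> (nat \<Rightarrow> 'a) \<Rightarrow> 's \<times> 's) set" where
  "ident f e S q B \<epsilon> p G =
     (THE Z. \<exists>g\<in>G. Z = Ext_class (res_Af f e q B \<epsilon>) (as_Af_mod S) p (hat f e (q p) g))"


section \<open>Well-definedness of the identification\<close>

text \<open>
  \<open>A\<^sub>f\<close> is a unital ring, the modules above are modules over it, and \<open>ident\<close> is bijective. By
  minimality all coboundaries vanish, so Ext classes are singletons.
\<close>

lemma left_moduleD:
  assumes "left_module mul u M"
  shows "0 \<in> carr M" "x \<in> carr M \<Longrightarrow> y \<in> carr M \<Longrightarrow> x - y \<in> carr M"
    "x \<in> carr M \<Longrightarrow> y \<in> carr M \<Longrightarrow> x + y \<in> carr M"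
    "x \<in> carr M \<Longrightarrow> act M a x \<in> carr M"
    "act M a 0 = 0"
    "x \<in> carr M \<Longrightarrow> act M 0 x = 0"
proof -
  show *: "0 \<in> carr M" "\<And>x y. x \<in> carr M \<Longrightarrow> y \<in> carr M \<Longrightarrow> x - y \<in> carr M"
    "x \<in> carr M \<Longrightarrow> act M a x \<in> carr M"
    using assms unfolding left_module_def by blast+
  show "x \<in> carr M \<Longrightarrow> y \<in> carr M \<Longrightarrow> x + y \<in> carr M"
    using *(2)[of x "0 - y"] *(2)[of 0 y] *(1) by simp
  have "act M a (0 + 0) = act M a 0 + act M a 0"
    using assms *(1) unfolding left_module_def by blast
  then show "act M a 0 = 0" by simp
  assume "x \<in> carr M"
  then have "act M (0 + 0) x = act M 0 x + act M 0 x"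
    using assms unfolding left_module_def by blast
  then show "act M 0 x = 0" by simp
qed

lemma Hom_zero:
  assumes "u \<in> Hom M N"
  shows "u 0 = 0"
proof (cases "0 \<in> carr M")
  case True
  then have "u (0 + 0) = u 0 + u 0" using assms unfolding Hom_def by blast
  then show ?thesis by simp
next
  case False
  then show ?thesis using assms unfolding Hom_def by blast
qed

lemma Hom_diff:
  assumes u: "u \<in> Hom M N" and M: "left_module mul one M" and x: "x \<in> carr M" "y \<in> carr M"
  shows "u (x - y) = u x - u y"
proof -
  have "x - y \<in> carr M" using left_moduleD(2)[OF M x] .
  then have "u (x - y + y) = u (x - y) + u y" using u x unfolding Hom_def by blast
  then show ?thesis by simp
qed

lemma Qmod_carr_iff:
  "x \<in> carr (Qmod e js) \<longleftrightarrow>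
    (\<forall>r<length js. x r \<in> range (\<lambda>a. a * e (js ! r))) \<and> (\<forall>r\<ge>length js. x r = 0)"
  by (simp add: Qmod_def P_def)

lemma left_module_Qmod: "left_module (*) 1 (Qmod e js)"
  unfolding left_module_def
proof (intro conjI ballI allI)
  show "0 \<in> carr (Qmod e js)"
    unfolding Qmod_carr_iff by (auto intro: rev_image_eqI[where x=0])
next
  fix x y assume "x \<in> carr (Qmod e js)" "y \<in> carr (Qmod e js)"
  then show "x - y \<in> carr (Qmod e js)"
    unfolding Qmod_carr_iff by (auto simp: image_iff) (metis left_diff_distrib)
next
  fix x a assume "x \<in> carr (Qmod e js)"
  then show "act (Qmod e js) a x \<in> carr (Qmod e js)"
    unfolding Qmod_carr_iff by (auto simp: image_iff Qmod_def) (metis mult.assoc)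
qed (auto simp: Qmod_def fun_eq_iff algebra_simps)

lemma Qmod_idem:
  assumes "x \<in> carr (Qmod e js)" "r < length js" "e (js!r) * e (js!r) = e (js!r)"
  shows "x r * e (js ! r) = x r"
  using assms unfolding Qmod_carr_iff by (auto simp: image_iff) (metis mult.assoc)

lemma basic_idem: "basic_idempotents n e \<Longrightarrow> i < n \<Longrightarrow> e i * e i = e i"
  by (auto simp: basic_idempotents_def primitive_idempotent_def)

lemma T_of_matrix_mem: "T_of_matrix f e js js' B x \<in> carr (Qmod e js')"
  unfolding T_of_matrix_def zext_def Qmod_carr_iff by (auto intro: rev_image_eqI[where x=0])

lemma hom_of_matrix_mem:
  assumes "is_hom_matrix e js js' B"
  shows "hom_of_matrix e js js' B x \<in> carr (Qmod e js')"
proof -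
  have "(\<Sum>l<length js. x l * B l s) \<in> range (\<lambda>a. a * e (js' ! s))" if "s < length js'" for s
  proof
    show "(\<Sum>l<length js. x l * B l s) = (\<Sum>l<length js. x l * (e (js ! l) * B l s)) * e (js' ! s)"
      unfolding sum_distrib_right
      by (rule sum.cong) (use assms that in \<open>auto simp: is_hom_matrix_def mult.assoc\<close>)
  qed simp
  then show ?thesis
    unfolding hom_of_matrix_def zext_def Qmod_carr_iff
    by (auto intro: rev_image_eqI[where x=0])
qed

lemma cocycleD:
  assumes "hochschild_2cocycle scale f"
  shows "f a (b + c) = f a b + f a c" "f (a + b) c = f a c + f b c" "f 0 a = 0" "f a 0 = 0"
    "f a (b - c) = f a b - f a c"
    "f a (sum g X) = (\<Sum>x\<in>X. f a (g x))"
    "a * f b c - f (a * b) c + f a (b * c) - f a b * c = 0"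
proof -
  have 1: "Vector_Spaces.linear scale scale (f a)" for a
    using assms by (simp add: hochschild_2cocycle_def)
  have 2: "Vector_Spaces.linear scale scale (\<lambda>a. f a b)" for b
    using assms by (simp add: hochschild_2cocycle_def)
  interpret l1: Vector_Spaces.linear scale scale "f a" by (rule 1)
  interpret l2: Vector_Spaces.linear scale scale "\<lambda>a. f a c" by (rule 2)
  interpret l3: Vector_Spaces.linear scale scale "\<lambda>b. f b a" by (rule 2)
  show "f a (b + c) = f a b + f a c" "f (a + b) c = f a c + f b c" "f 0 a = 0" "f a 0 = 0"
    "f a (b - c) = f a b - f a c"
    "f a (sum g X) = (\<Sum>x\<in>X. f a (g x))"
    using l1.add l2.add l3.zero l1.zero l1.diff l1.sum by auto
  show "a * f b c - f (a * b) c + f a (b * c) - f a b * c = 0"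
    using assms by (simp add: hochschild_2cocycle_def)
qed

lemma f_Q_mem: "f_Q f e js a x \<in> carr (Qmod e js)"
  unfolding Qmod_carr_iff f_Q_def by auto

lemma Af_ring:
  assumes c: "hochschild_2cocycle scale f"
  shows "Af_mult f (Af_mult f x y) z = Af_mult f x (Af_mult f y z)"
    "Af_mult f (Af_one f) x = x" "Af_mult f x (Af_one f) = x"
    "Af_mult f (x + y) z = Af_mult f x z + Af_mult f y z"
    "Af_mult f x (y + z) = Af_mult f x y + Af_mult f x z"
proof -
  note C = cocycleD[OF c]
  show "Af_mult f (Af_mult f x y) z = Af_mult f x (Af_mult f y z)"
    using C(7)[of "fst x" "fst y" "fst z"]
    by (auto simp: Af_mult_def split_beta algebra_simps)
  show "Af_mult f (Af_one f) x = x"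
    using C(7)[of 1 1 "fst x"] by (auto simp: Af_mult_def Af_one_def split_beta prod_eq_iff)
  show "Af_mult f x (Af_one f) = x"
    using C(7)[of "fst x" 1 1] by (auto simp: Af_mult_def Af_one_def split_beta prod_eq_iff)
qed (auto simp: Af_mult_def split_beta algebra_simps cocycleD[OF c])

lemma Qhat_simps:
  "carr (Qhat f e js) = carr (Qmod e js) \<times> carr (Qmod e js)"
  "act (Qhat f e js) (a, b) (x, y) =
     (\<lambda>r. a * x r, (\<lambda>r. a * y r + b * x r + f_Q f e js a x r))"
  by (auto simp: Qhat_def tuple_mod_def Qmod_def)

lemma left_module_Qhat:
  fixes f :: "'a::ring_1 \<Rightarrow> 'a \<Rightarrow> 'a"
  assumes c: "hochschild_2cocycle scale f" and "\<And>j. j \<in> set js \<Longrightarrow> e j * e j = e j"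
  shows "left_module (Af_mult f) (Af_one f) (Qhat f e js)"
proof -
  note C = cocycleD[OF c]
  note Q = left_moduleD[OF left_module_Qmod[of e js]]
  note M = left_module_Qmod[of e js, unfolded left_module_def]
  have act: "act (Qmod e js) = (\<lambda>a x r. a * x r)" by (simp add: Qmod_def)
  have C7: "f (a * b) x = a * f b x + f a (b * x) - f a b * x" for a b x
    using C(7)[of a b x] by (simp add: algebra_simps)
  have fm: "f_Q f e js (a * b) x r = a * f_Q f e js b x r + f_Q f e js a (\<lambda>r. b * x r) r - f a b * x r"
    if x: "x \<in> carr (Qmod e js)" for a b x r
  proof (cases "r < length js")
    case True
    have "x r * e (js ! r) = x r" using Qmod_idem[OF x True] assms(2) True by simp
    then show ?thesis using True by (simp add: f_Q_def C7 algebra_simps)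
  next
    case False
    then show ?thesis using x by (auto simp: f_Q_def Qmod_carr_iff)
  qed
  have f1: "f_Q f e js 1 x r = f 1 1 * x r" if x: "x \<in> carr (Qmod e js)" for x r
    using fm[OF x, of 1 1 r] by simp
  show ?thesis
    unfolding left_module_def
  proof (intro conjI ballI allI)
    fix a x assume x: "x \<in> carr (Qhat f e js)"
    show "act (Qhat f e js) a x \<in> carr (Qhat f e js)"
      using x by (cases a; cases x)
       (auto simp: Qhat_def tuple_mod_def intro!: Q(3,4) f_Q_mem)
  next
    fix x y assume "x \<in> carr (Qhat f e js)" "y \<in> carr (Qhat f e js)"
    then show "x - y \<in> carr (Qhat f e js)" using Q(2) by (auto simp: Qhat_simps)
  next
    fix a b :: "'a \<times> 'a" and x assume x: "x \<in> carr (Qhat f e js)"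
    obtain x0 x1 where "x = (x0,x1)" by force
    moreover obtain a0 a1 b0 b1 where "a = (a0,a1)" "b=(b0,b1)" by force
    ultimately show "act (Qhat f e js) (Af_mult f a b) x = act (Qhat f e js) a (act (Qhat f e js) b x)"
      using x by (auto simp: Qhat_simps Af_mult_def fun_eq_iff algebra_simps fm)
  next
    fix x assume x: "x \<in> carr (Qhat f e js)"
    then show "act (Qhat f e js) (Af_one f) x = x"
      by (cases x) (auto simp: Qhat_simps Af_one_def fun_eq_iff f1)
  qed (use Q(1) in \<open>auto simp: Qhat_simps zero_prod_def fun_eq_iff f_Q_def C algebra_simps\<close>)
qed

lemma as_Af_simps:
  "carr (as_Af_mod S) = {0} \<times> carr S"
  "act (as_Af_mod S) (a, b) (x, y) = (0, act S a y + act S b 0)"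
  by (auto simp: as_Af_mod_def tuple_mod_def zero_mod_def)

lemma left_module_as_Af:
  assumes c: "hochschild_2cocycle scale f" and "left_module (*) 1 S"
  shows "left_module (Af_mult f) (Af_one f) (as_Af_mod S)"
proof -
  note M = left_moduleD[OF assms(2)]
  have add: "act S a (x + y) = act S a x + act S a y" "act S (a + b) x = act S a x + act S b x"
    "act S (a * b) x = act S a (act S b x)" "act S 1 x = x"
    if "x \<in> carr S" "y \<in> carr S" for a b x y
    using assms(2) that by (simp_all add: left_module_def)
  show ?thesis
    unfolding left_module_def
    by (auto simp: as_Af_simps Af_mult_def Af_one_def zero_prod_def M add)
qed

lemma hat_in_Hom:
  fixes f :: "'a::ring_1 \<Rightarrow> 'a \<Rightarrow> 'a"
  assumes "left_module (*) 1 S" "g \<in> Hom (Qmod e js) S"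
  shows "hat f e js g \<in> Hom (Qhat f e js) (as_Af_mod S)"
  unfolding Hom_def
proof (intro CollectI conjI allI impI ballI)
  have Q: "act (Qmod e js) = (\<lambda>a x r. a * x r)" by (simp add: Qmod_def)
  note Qc = left_moduleD[OF left_module_Qmod[of e js]]
  fix c :: "'a \<times> 'a" and z assume z: "z \<in> carr (Qhat f e js)"
  obtain a b x y where [simp]: "c = (a,b)" "z = (x,y)" by (cases c; cases z)
  have "act (Qhat f e js) (a,b) (x,y) \<in> carr (Qhat f e js)"
    using z by (auto simp: Qhat_def tuple_mod_def intro!: Qc(3,4) f_Q_mem)
  then show "hat f e js g (act (Qhat f e js) c z) = act (as_Af_mod S) c (hat f e js g z)"
    using z assms left_moduleD(5)[OF assms(1)]
    by (auto simp: hat_def triple_map_def zext_def Qhat_simps as_Af_simps Hom_def Q)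
next
  fix z assume "z \<in> carr (Qhat f e js)"
  then show "hat f e js g z \<in> carr (as_Af_mod S)"
    using assms(2) by (auto simp: hat_def triple_map_def zext_def Qhat_simps as_Af_simps Hom_def)
next
  fix z w assume zw: "z \<in> carr (Qhat f e js)" "w \<in> carr (Qhat f e js)"
  obtain a b where z: "z = (a, b)" by (cases z)
  obtain c d where w: "w = (c, d)" by (cases w)
  have mem: "a \<in> carr (Qmod e js)" "b \<in> carr (Qmod e js)" "c \<in> carr (Qmod e js)" "d \<in> carr (Qmod e js)"
    using zw by (auto simp: z w Qhat_simps)
  have "g (a + c) = g a + g c" using assms(2) mem by (simp add: Hom_def)
  then show "hat f e js g (z + w) = hat f e js g z + hat f e js g w"
    using left_moduleD(3)[OF left_module_Qmod[of e js]] mem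
    by (simp add: z w hat_def triple_map_def zext_def Qhat_simps)
next
  fix z assume "z \<notin> carr (Qhat f e js)"
  then show "hat f e js g z = 0" by (simp add: hat_def triple_map_def zext_def zero_prod_def)
qed

lemma Hom_Qhat_eq:
  assumes c: "hochschild_2cocycle scale f" and S: "left_module (*) 1 S"
  shows "Hom (Qhat f e js) (as_Af_mod S) = hat f e js ` Hom (Qmod e js) S"
proof (intro subset_antisym subsetI)
  fix u assume u: "u \<in> Hom (Qhat f e js) (as_Af_mod S)"
  note C = cocycleD[OF c]
  note Qc = left_moduleD[OF left_module_Qmod[of e js]]
  have Q: "act (Qmod e js) = (\<lambda>a x r. a * x r)" by (simp add: Qmod_def)
  let ?C = "carr (Qmod e js)"
  have uz: "u z \<in> carr (as_Af_mod S)" for z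
  proof (cases "z \<in> carr (Qhat f e js)")
    case True
    then show ?thesis using u unfolding Hom_def by blast
  next
    case False
    then have "u z = 0" using u unfolding Hom_def by blast
    then show ?thesis using left_moduleD(1)[OF S] by (simp add: as_Af_simps zero_prod_def)
  qed
  have fst0: "fst (u z) = 0" and sndS: "snd (u z) \<in> carr S" for z
    using uz[of z] by (auto simp: as_Af_simps mem_Times_iff)
  have lin: "u (act (Qhat f e js) a z) = act (as_Af_mod S) a (u z)" if "z \<in> carr (Qhat f e js)" for a z
    using u that unfolding Hom_def by blast
  have add: "u (z + w) = u z + u w" if "z \<in> carr (Qhat f e js)" "w \<in> carr (Qhat f e js)" for z w
    using u that by (auto simp: Hom_def)
  have u0: "u (0, x) = 0" if x: "x \<in> ?C" for x
  proof -
    have *: "act (Qhat f e js) (0, 1) (x, 0) = (0, x)"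
      by (auto simp: Qhat_simps f_Q_def C fun_eq_iff)
    have "u (0, x) = act (as_Af_mod S) (0, 1) (u (x, 0))"
      unfolding *[symmetric] by (rule lin) (use x Qc(1) in \<open>auto simp: Qhat_simps\<close>)
    then show ?thesis
      using fst0[of "(x,0)"] sndS[of "(x,0)"] left_moduleD(5,6)[OF S]
      by (cases "u (x,0)") (auto simp: as_Af_simps zero_prod_def)
  qed
  have ux: "u (x, y) = u (x, 0)" if "x \<in> ?C" "y \<in> ?C" for x y
    using add[of "(x,0)" "(0,y)"] that Qc(1) u0[of y] by (auto simp: Qhat_simps)
  define g where "g = zext ?C (\<lambda>x. snd (u (x, 0)))"
  have "g \<in> Hom (Qmod e js) S"
    unfolding Hom_def
  proof (clarsimp, intro conjI ballI allI impI)
    fix x assume x: "x \<in> ?C"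
    show "g x \<in> carr S" using x sndS by (auto simp: g_def zext_def)
    fix y assume y: "y \<in> ?C"
    show "g (x + y) = g x + g y"
      using x y Qc(1) Qc(3)[OF x y] add[of "(x,0)" "(y,0)"] by (auto simp: g_def zext_def Qhat_simps)
  next
    fix a x assume x: "x \<in> ?C"
    have *: "act (Qhat f e js) (a, 0) (x, 0) = (act (Qmod e js) a x, f_Q f e js a x)"
      by (auto simp: Qhat_simps Q fun_eq_iff)
    have "u (act (Qmod e js) a x, 0) = act (as_Af_mod S) (a, 0) (u (x, 0))"
      using lin[of "(x,0)" "(a,0)"] x Qc(1) ux[OF Qc(4)[OF x] f_Q_mem] by (auto simp: Qhat_simps(1) *)
    then show "g (act (Qmod e js) a x) = act S a (g x)"
      using x Qc(4)[OF x] fst0[of "(x,0)"] left_moduleD(5)[OF S] by (cases "u (x,0)") (auto simp: g_def zext_def as_Af_simps)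
  next
    fix x assume "x \<notin> ?C" then show "g x = 0" by (simp add: g_def zext_def)
  qed
  moreover have "u = hat f e js g"
  proof
    fix z
    show "u z = hat f e js g z"
    proof (cases "z \<in> carr (Qhat f e js)")
      case True
      obtain a b where z: "z = (a, b)" by (cases z)
      show ?thesis unfolding z using True[unfolded z] ux[of a b] fst0 by (simp add: hat_def triple_map_def zext_def g_def Qhat_simps prod_eq_iff)
    next
      case False
      then have "u z = 0" using u unfolding Hom_def by blast
      then show ?thesis using False by (simp add: hat_def triple_map_def zext_def zero_prod_def)
    qed
  qed
  ultimately show "u \<in> hat f e js ` Hom (Qmod e js) S" by blast
next
  fix u assume "u \<in> hat f e js ` Hom (Qmod e js) S"
  then obtain g where g: "u = hat f e js g" "g \<in> Hom (Qmod e js) S" by (rule imageE)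
  show "u \<in> Hom (Qhat f e js) (as_Af_mod S)" unfolding g(1) by (rule hat_in_Hom[OF S g(2)])
qed

lemma hat_inj: "inj_on (hat f e js) (Hom (Qmod e js) S)"
proof (rule inj_onI, rule ext)
  fix g h x assume *: "g \<in> Hom (Qmod e js) S" "h \<in> Hom (Qmod e js) S" "hat f e js g = hat f e js h"
  show "g x = h x"
  proof (cases "x \<in> carr (Qmod e js)")
    case True
    then show ?thesis
      using fun_cong[OF *(3), of "(x,0)"] left_moduleD(1)[OF left_module_Qmod[of e js]]
      by (auto simp: hat_def triple_map_def zext_def Qhat_simps)
  qed (use * in \<open>auto simp: Hom_def\<close>)
qed

lemma left_module_P: "left_module (*) 1 (P x)"
  unfolding left_module_def
proof (intro conjI ballI allI)
  show "0 \<in> carr (P x)" by (auto simp: P_def intro: rev_image_eqI[where x=0])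
next
  fix y z assume "y \<in> carr (P x)" "z \<in> carr (P x)"
  then obtain a b where "y = a * x" "z = b * x" by (auto simp: P_def)
  then have "y - z = (a - b) * x" by (simp add: algebra_simps)
  then show "y - z \<in> carr (P x)" by (auto simp: P_def)
next
  fix a y assume "y \<in> carr (P x)"
  then obtain b where "y = b * x" by (auto simp: P_def)
  then have "a * y = (a * b) * x" by (simp add: algebra_simps)
  then show "act (P x) a y \<in> carr (P x)" by (auto simp: P_def)
qed (auto simp: P_def algebra_simps)

lemma superfluous_Hom_zero:
  fixes Q :: "('a::ring_1, 'm::ab_group_add) lmod" and S :: "('a, 's::ab_group_add) lmod"
  assumes Q: "left_module (*) 1 Q" and S: "sum_of_simples n e S" and K: "submodule K Q"
    and sup: "superfluous K Q" and u: "u \<in> Hom Q S" and x: "x \<in> K"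
  shows "u x = 0"
proof (rule ccontr)
  assume ne: "u x \<noteq> 0"
  have SM: "left_module (*) 1 S" using S by (simp add: sum_of_simples_def)
  obtain L where LL: "\<forall>i<n. submodule (L i) S \<and>
                  is_quotient \<lparr>carr = L i, act = act S\<rparr> (P (e i)) (rad (P (e i)))"
    and LE: "\<forall>x\<in>carr S. \<exists>!y. (\<forall>i<n. y i \<in> L i) \<and> (\<forall>i\<ge>n. y i = 0) \<and> x = (\<Sum>i<n. y i)"
    using S unfolding sum_of_simples_def by (elim conjE exE)
  have L: "submodule (L i) S" "is_quotient \<lparr>carr = L i, act = act S\<rparr> (P (e i)) (rad (P (e i)))" if "i < n" for i
    using LL that by auto
  note ex = bspec[OF LE]
  define c where "c x = (THE y. (\<forall>i<n. y i \<in> L i) \<and> (\<forall>i\<ge>n. y i = 0) \<and> x = (\<Sum>i<n. y i))" for x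
  have c: "(\<forall>i<n. c x i \<in> L i) \<and> (\<forall>i\<ge>n. c x i = 0) \<and> x = (\<Sum>i<n. c x i)" if "x \<in> carr S" for x
    unfolding c_def by (rule theI'[OF ex[OF that]])
  have cu: "c x = y" if "x \<in> carr S" "\<forall>i<n. y i \<in> L i" "\<forall>i\<ge>n. y i = 0" "x = (\<Sum>i<n. y i)" for x y
    unfolding c_def by (rule the1_equality[OF ex[OF that(1)]]) (use that in blast)
  have Ladd: "y + z \<in> L i" if "i < n" "y \<in> L i" "z \<in> L i" for i y z
  proof -
    have "0 - z \<in> L i" using L(1)[OF that(1)] that unfolding submodule_def by blast
    then have "y - (0 - z) \<in> L i" using L(1)[OF that(1)] that unfolding submodule_def by blast
    then show ?thesis by simp
  qed
  have cadd: "c (y + z) = (\<lambda>i. c y i + c z i)" if "y \<in> carr S" "z \<in> carr S" for y z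
    apply (rule cu) using c[OF that(1)] c[OF that(2)] Ladd left_moduleD(3)[OF SM that] by (auto simp: sum.distrib)
  have cdiff: "c (y - z) i = c y i - c z i" if "y \<in> carr S" "z \<in> carr S" for y z i
    using cadd[of "y - z" z] that left_moduleD(2)[OF SM that] by simp
  have actsum: "act S a (\<Sum>i<k. y i) = (\<Sum>i<k. act S a (y i)) \<and> (\<Sum>i<k. y i) \<in> carr S"
    if "\<And>i. i < k \<Longrightarrow> y i \<in> carr S" for a y and k :: nat
    using that
  proof (induction k)
    case 0 then show ?case using left_moduleD[OF SM] by auto
  next
    case (Suc k)
    then show ?case using left_moduleD(3)[OF SM] SM by (auto simp: left_module_def)
  qed
  have LS: "L i \<subseteq> carr S" if "i < n" for i using L(1)[OF that] by (simp add: submodule_def)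
  have cact: "c (act S a y) = (\<lambda>i. act S a (c y i))" if y: "y \<in> carr S" for a y
  proof (rule cu)
    show "\<forall>i<n. act S a (c y i) \<in> L i" using c[OF y] L(1) by (simp add: submodule_def)
    show "act S a y = (\<Sum>i<n. act S a (c y i))"
      using actsum[of n "c y" a] c[OF y] LS by auto
  qed (use left_moduleD[OF SM] y c[OF y] in auto)
  have KQ: "K \<subseteq> carr Q" using K by (simp add: submodule_def)
  have uS: "u z \<in> carr S" if "z \<in> carr Q" for z using u that by (simp add: Hom_def)
  have "\<exists>i<n. c (u x) i \<noteq> 0"
    using c[OF uS, of x] x KQ ne by (metis (no_types, lifting) lessThan_iff subsetD sum.neutral)
  then obtain i where i: "i < n" "c (u x) i \<noteq> 0" by blast
  define v where "v z = c (u z) i" for z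
  have vL: "v z \<in> L i" if "z \<in> carr Q" for z using c[OF uS[OF that]] i by (simp add: v_def)
  have uadd: "u (y - z) = u y - u z" if "y \<in> carr Q" "z \<in> carr Q" for y z
    using Hom_diff[OF u Q that] .
  have vdiff: "v (y - z) = v y - v z" if "y \<in> carr Q" "z \<in> carr Q" for y z
    using cdiff uS that by (simp add: v_def uadd)
  have vact: "v (act Q a y) = act S a (v y)" if "y \<in> carr Q" for a y
    using cact uS that u by (simp add: v_def Hom_def)
  obtain \<pi> where \<pi>: "\<pi> \<in> Hom (P (e i)) \<lparr>carr = L i, act = act S\<rparr>" "\<pi> ` carr (P (e i)) = L i"
      "ker_on (P (e i)) \<pi> = rad (P (e i))"
    using L(2)[OF i(1)] by (auto simp: is_quotient_def)
  note PM = left_module_P[of "e i"]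
  obtain y where y: "y \<in> carr (P (e i))" "\<pi> y = v x" using \<pi>(2) vL x KQ by (metis imageE subsetD)
  then have "y \<notin> rad (P (e i))" using i unfolding \<pi>(3)[symmetric] by (simp add: v_def ker_on_def)
  then obtain N where N: "maximal_submodule N (P (e i))" "y \<notin> N" using y by (auto simp: rad_def)
  have Ns: "submodule N (P (e i))" using N by (simp add: maximal_submodule_def)
  have ker: "ker_on (P (e i)) \<pi> \<subseteq> N" using \<pi>(3) N(1) by (auto simp: rad_def)
  have pd: "\<pi> (a - b) = \<pi> a - \<pi> b" if "a \<in> carr (P (e i))" "b \<in> carr (P (e i))" for a b
    using Hom_diff[OF \<pi>(1) PM that] .
  have pmem: "w \<in> N" if w: "w \<in> carr (P (e i))" "\<pi> w \<in> \<pi> ` N" for w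
  proof -
    note that = w
    obtain n0 where n0: "n0 \<in> N" "\<pi> w = \<pi> n0" using w(2) by blast
    have n0c: "n0 \<in> carr (P (e i))" using n0 Ns by (auto simp: submodule_def)
    have "w - n0 \<in> N" using ker pd[OF that(1) n0c] n0 left_moduleD(2)[OF PM that(1) n0c] by (auto simp: ker_on_def)
    then have "(w - n0) - (0 - n0) \<in> N" using Ns n0 unfolding submodule_def by blast
    then show ?thesis by simp
  qed
  define V where "V = {z \<in> carr Q. v z \<in> \<pi> ` N}"
  have NP: "N \<subseteq> carr (P (e i))" using Ns by (simp add: submodule_def)
  have pact: "\<pi> (act (P (e i)) a w) = act S a (\<pi> w)" if "w \<in> carr (P (e i))" for a w
    using \<pi>(1) that by (simp add: Hom_def)
  have pN0: "0 \<in> \<pi> ` N" using Hom_zero[OF \<pi>(1)] Ns by (metis imageI submodule_def)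
  have pNd: "a - b \<in> \<pi> ` N" if ab: "a \<in> \<pi> ` N" "b \<in> \<pi> ` N" for a b
  proof -
    obtain a' b' where *: "a' \<in> N" "b' \<in> N" "a = \<pi> a'" "b = \<pi> b'" using ab by blast
    then have "a - b = \<pi> (a' - b')" using pd NP by (simp add: subset_iff)
    moreover have "a' - b' \<in> N" using Ns * by (simp add: submodule_def)
    ultimately show ?thesis by blast
  qed
  have pNa: "act S r a \<in> \<pi> ` N" if ab: "a \<in> \<pi> ` N" for r a
  proof -
    obtain a' where *: "a' \<in> N" "a = \<pi> a'" using ab by blast
    then have "act S r a = \<pi> (act (P (e i)) r a')" using pact NP by (simp add: subset_iff)
    moreover have "act (P (e i)) r a' \<in> N" using Ns * by (simp add: submodule_def)
    ultimately show ?thesis by blast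
  qed
  have Vs: "submodule V Q"
    unfolding submodule_def
  proof (intro conjI ballI allI)
    show "V \<subseteq> carr Q" by (auto simp: V_def)
    have "v 0 = 0" using vdiff[of 0 0] left_moduleD(1)[OF Q] by simp
    moreover have "0 \<in> \<pi> ` N" using Hom_zero[OF \<pi>(1)] Ns by (metis imageI submodule_def)
    ultimately show "0 \<in> V" using left_moduleD(1)[OF Q] by (simp add: V_def)
  next
    fix a b assume ab: "a \<in> V" "b \<in> V"
    then show "a - b \<in> V" using vdiff pNd left_moduleD(2)[OF Q] by (simp add: V_def)
  next
    fix r a assume a: "a \<in> V"
    then show "act Q r a \<in> V" using vact pNa left_moduleD(4)[OF Q] by (simp add: V_def)
  qed
  define W where "W = {w \<in> carr (P (e i)). \<exists>k\<in>K. \<pi> w - v k \<in> \<pi> ` N}"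
  have Ws: "submodule W (P (e i))"
    unfolding submodule_def
  proof (intro conjI ballI allI)
    show "W \<subseteq> carr (P (e i))" by (auto simp: W_def)
    have "v 0 = 0" using vdiff[of 0 0] left_moduleD(1)[OF Q] by simp
    then show "0 \<in> W" using pN0 Hom_zero[OF \<pi>(1)] K left_moduleD(1)[OF PM]
      by (auto simp: W_def submodule_def intro!: bexI[of _ 0])
  next
    fix a b assume ab: "a \<in> W" "b \<in> W"
    then obtain k l where kl: "k \<in> K" "l \<in> K" "\<pi> a - v k \<in> \<pi> ` N" "\<pi> b - v l \<in> \<pi> ` N"
      and c': "a \<in> carr (P (e i))" "b \<in> carr (P (e i))" by (auto simp: W_def)
    have "\<pi> (a - b) - v (k - l) = (\<pi> a - v k) - (\<pi> b - v l)"
      using pd[OF c'] vdiff[OF subsetD[OF KQ kl(1)] subsetD[OF KQ kl(2)]] by simp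
    then have "\<pi> (a - b) - v (k - l) \<in> \<pi> ` N" using pNd kl by metis
    moreover have "k - l \<in> K" using K kl by (simp add: submodule_def)
    ultimately show "a - b \<in> W" using left_moduleD(2)[OF PM c'] unfolding W_def by blast
  next
    fix r a assume a: "a \<in> W"
    then obtain k where k: "k \<in> K" "\<pi> a - v k \<in> \<pi> ` N" and c': "a \<in> carr (P (e i))" by (auto simp: W_def)
    then obtain m where m: "m \<in> N" "\<pi> a - v k = \<pi> m" by auto
    have mc: "m \<in> carr (P (e i))" using m NP by blast
    have k1: "v k = \<pi> (a - m)" using pd[OF c' mc] m by (simp add: algebra_simps)
    have am: "a - m \<in> carr (P (e i))" by (rule left_moduleD(2)[OF PM c' mc])
    have "act (P (e i)) r (a - m) = act (P (e i)) r a - act (P (e i)) r m"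
      by (simp add: P_def algebra_simps)
    then have "v (act Q r k) = \<pi> (act (P (e i)) r a) - \<pi> (act (P (e i)) r m)"
      using vact[of k r] k KQ k1 pact[OF am, of r] pd left_moduleD(4)[OF PM] c' mc by auto
    then have "\<pi> (act (P (e i)) r a) - v (act Q r k) \<in> \<pi> ` N"
      using m(1) Ns by (auto simp: submodule_def)
    moreover have "act Q r k \<in> K" using K k by (simp add: submodule_def)
    ultimately show "act (P (e i)) r a \<in> W" using left_moduleD(4)[OF PM c'] by (auto simp: W_def)
  qed
  have "N \<subseteq> W"
  proof
    fix w assume "w \<in> N"
    moreover have "v 0 = 0" using vdiff[of 0 0] left_moduleD(1)[OF Q] by simp
    ultimately show "w \<in> W" using NP K by (auto simp: W_def submodule_def intro!: bexI[of _ 0])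
  qed
  moreover have "y \<in> W" using y pN0 x by (auto simp: W_def intro!: bexI[of _ x])
  ultimately have W: "W = carr (P (e i))" using N Ws by (auto simp: maximal_submodule_def)
  have "{k + z | k z. k \<in> K \<and> z \<in> V} = carr Q"
  proof (intro subset_antisym subsetI)
    fix z assume "z \<in> {k + z | k z. k \<in> K \<and> z \<in> V}"
    then show "z \<in> carr Q" using KQ left_moduleD(3)[OF Q] by (auto simp: V_def)
  next
    fix z assume z: "z \<in> carr Q"
    then obtain w where w: "w \<in> carr (P (e i))" "\<pi> w = v z" using \<pi>(2) vL by (metis imageE)
    then have "w \<in> W" using W by simp
    then obtain k where k: "k \<in> K" "v z - v k \<in> \<pi> ` N" using w unfolding W_def by auto
    have kQ: "k \<in> carr Q" using k KQ by blast
    have "z - k \<in> V" using k vdiff[OF z kQ] left_moduleD(2)[OF Q z kQ] by (simp add: V_def)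
    then have "z = k + (z - k) \<and> k \<in> K \<and> z - k \<in> V" using k by simp
    then show "z \<in> {k + z | k z. k \<in> K \<and> z \<in> V}" by blast
  qed
  then have "V = carr Q" using sup Vs by (auto simp: superfluous_def)
  then have "v x \<in> \<pi> ` N" using x KQ by (auto simp: V_def)
  then show False using pmem[OF y(1)] y N(2) by auto
qed

lemma submodule_ker:
  assumes "left_module mul one M" "left_module mul one N" "u \<in> Hom M N"
  shows "submodule (ker_on M u) M"
  unfolding submodule_def
proof (intro conjI ballI allI)
  fix a x assume x: "x \<in> ker_on M u"
  then have "u (act M a x) = act N a (u x)" using assms(3) by (simp add: Hom_def ker_on_def)
  then show "act M a x \<in> ker_on M u"
    using x left_moduleD(4)[OF assms(1)] left_moduleD(5)[OF assms(2)] by (simp add: ker_on_def)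
next
  fix x y assume "x \<in> ker_on M u" "y \<in> ker_on M u"
  then show "x - y \<in> ker_on M u"
    using Hom_diff[OF assms(3,1), of x y] left_moduleD(2)[OF assms(1), of x y] by (simp add: ker_on_def)
next
  show "ker_on M u \<subseteq> carr M" by (auto simp: ker_on_def)
  show "0 \<in> ker_on M u" using Hom_zero[OF assms(3)] left_moduleD(1)[OF assms(1)] by (simp add: ker_on_def)
qed

lemma hom_of_matrix_Hom:
  assumes "is_hom_matrix e js js' B"
  shows "hom_of_matrix e js js' B \<in> Hom (Qmod e js) (Qmod e js')"
proof -
  have Q: "act (Qmod e js) = (\<lambda>a x r. a * x r)" for js by (simp add: Qmod_def)
  note Qc = left_moduleD[OF left_module_Qmod[of e js]]
  have 4: "(\<lambda>r. a * x r) \<in> carr (Qmod e js)" if "x \<in> carr (Qmod e js)" for a x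
    using Qc(4)[OF that, of a] by (simp add: Q)
  have mem: "hom_of_matrix e js js' B x \<in> carr (Qmod e js')" for x
    by (rule hom_of_matrix_mem[OF assms])
  have eq: "hom_of_matrix e js js' B x = (\<lambda>s. if s < length js' then (\<Sum>l<length js. x l * B l s) else 0)"
    if "x \<in> carr (Qmod e js)" for x
    using that by (simp add: hom_of_matrix_def zext_def)
  show ?thesis
    unfolding Hom_def
  proof (intro CollectI conjI ballI allI impI)
    fix x y assume x: "x \<in> carr (Qmod e js)" and y: "y \<in> carr (Qmod e js)"
    show "hom_of_matrix e js js' B (x + y) = hom_of_matrix e js js' B x + hom_of_matrix e js js' B y"
      by (simp add: eq x y Qc(3) fun_eq_iff distrib_right sum.distrib)
  next
    fix a x assume x: "x \<in> carr (Qmod e js)"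
    show "hom_of_matrix e js js' B (act (Qmod e js) a x) = act (Qmod e js') a (hom_of_matrix e js js' B x)"
      by (simp add: Q eq x 4 fun_eq_iff sum_distrib_left mult.assoc)
  next
    fix x assume "x \<notin> carr (Qmod e js)"
    then show "hom_of_matrix e js js' B x = 0" by (simp add: hom_of_matrix_def zext_def)
  qed (rule mem)
qed

lemma ident_bij:
  fixes S :: "('a::ring_1, 's::ab_group_add) lmod"
  assumes f: "hochschild_2cocycle scale f" and S: "sum_of_simples n e S"
    and R: "minimal_projective_resolution n e S q B \<epsilon>"
  shows "Ext (res_A e q B \<epsilon>) S p = (\<lambda>g. {g}) ` Hom (Qmod e (q p)) S"
    and "Ext (res_Af f e q B \<epsilon>) (as_Af_mod S) p = (\<lambda>g. {hat f e (q p) g}) ` Hom (Qmod e (q p)) S"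
    and "\<And>g. g \<in> Hom (Qmod e (q p)) S \<Longrightarrow> ident f e S q B \<epsilon> p {g} = {hat f e (q p) g}"
    and "bij_betw (ident f e S q B \<epsilon> p) (Ext (res_A e q B \<epsilon>) S p)
           (Ext (res_Af f e q B \<epsilon>) (as_Af_mod S) p)"
proof -
  have SM: "left_module (*) 1 S" using S by (simp add: sum_of_simples_def)
  have \<delta>H: "\<delta> e q B (Suc i) \<in> Hom (Qmod e (q (Suc i))) (Qmod e (q i))" for i
    using R hom_of_matrix_Hom[of e "q (Suc i)" "q i" "B (Suc i)"] unfolding \<delta>_def minimal_projective_resolution_def by simp
  have kill: "u (\<delta> e q B (Suc i) x) = 0" if u: "u \<in> Hom (Qmod e (q i)) S" for u i x
  proof (cases "x \<in> carr (Qmod e (q (Suc i)))")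
    case x: True
    show ?thesis
    proof (cases i)
      case 0
      have e: "\<epsilon> \<in> Hom (Qmod e (q 0)) S" "superfluous (ker_on (Qmod e (q 0)) \<epsilon>) (Qmod e (q 0))"
        "ker_on (Qmod e (q 0)) \<epsilon> = \<delta> e q B 1 ` carr (Qmod e (q 1))"
        using R by (auto simp: minimal_projective_resolution_def)
      show ?thesis
        using superfluous_Hom_zero[OF left_module_Qmod S submodule_ker[OF left_module_Qmod SM e(1)] e(2), of u] u e(3) x 0
        by auto
    next
      case (Suc j)
      have e: "superfluous (ker_on (Qmod e (q i)) (\<delta> e q B i)) (Qmod e (q i))"
        "ker_on (Qmod e (q i)) (\<delta> e q B i) = \<delta> e q B (Suc i) ` carr (Qmod e (q (Suc i)))"
        using R Suc by (auto simp: minimal_projective_resolution_def)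
      show ?thesis
      proof (rule superfluous_Hom_zero[OF left_module_Qmod S _ e(1) u])
        show "submodule (ker_on (Qmod e (q i)) (\<delta> e q B i)) (Qmod e (q i))"
          by (rule submodule_ker[OF left_module_Qmod left_module_Qmod]) (use \<delta>H[of j] Suc in simp)
        show "\<delta> e q B (Suc i) x \<in> ker_on (Qmod e (q i)) (\<delta> e q B i)" using e(2) x by simp
      qed
    qed
  next
    case False
    then have "\<delta> e q B (Suc i) x = 0" using \<delta>H[of i] by (simp add: Hom_def)
    then show ?thesis using Hom_zero[OF u] by simp
  qed
  have kill2: "hat f e (q i) u (\<delta>hat f e q B (Suc i) z) = 0"
    if u: "u \<in> Hom (Qmod e (q i)) S" for u i z
  proof (cases z)
    case (Pair x y)
    show ?thesis using kill[OF u] Hom_zero[OF u]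
      by (auto simp: Pair hat_def \<delta>hat_def triple_map_def zext_def zero_prod_def)
  qed
  have A0: "Ext_coboundaries (res_A e q B \<epsilon>) S p = {0}" for p
  proof (cases p)
    case (Suc j)
    have "u \<circ> \<delta> e q B (Suc j) = 0" if "u \<in> Hom (Qmod e (q j)) S" for u
      using kill[OF that] by (auto simp: fun_eq_iff)
    moreover have "(0::(nat \<Rightarrow> 'a) \<Rightarrow> 's) \<in> Hom (Qmod e (q j)) S"
      using left_moduleD[OF SM] by (auto simp: Hom_def)
    ultimately show ?thesis by (force simp: Ext_coboundaries_def res_A_def Suc)
  qed (simp add: Ext_coboundaries_def)
  have Ac: "Ext_cocycles (res_A e q B \<epsilon>) S p = Hom (Qmod e (q p)) S" for p
    using kill by (auto simp: Ext_cocycles_def res_A_def fun_eq_iff)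
  show 1: "Ext (res_A e q B \<epsilon>) S p = (\<lambda>g. {g}) ` Hom (Qmod e (q p)) S" for p
    by (auto simp: Ext_def Ext_class_def A0 Ac)
  note HQ = Hom_Qhat_eq[OF f SM]
  have B0: "Ext_coboundaries (res_Af f e q B \<epsilon>) (as_Af_mod S) p = {0}" for p
  proof (cases p)
    case (Suc j)
    have "hat f e (q j) u \<circ> \<delta>hat f e q B (Suc j) = 0" if "u \<in> Hom (Qmod e (q j)) S" for u
      using kill2[OF that] by (auto simp: fun_eq_iff)
    moreover have "(0::(nat \<Rightarrow> 'a) \<Rightarrow> 's) \<in> Hom (Qmod e (q j)) S"
      using left_moduleD[OF SM] by (auto simp: Hom_def)
    ultimately show ?thesis by (force simp: Ext_coboundaries_def res_Af_def Suc HQ)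
  qed (simp add: Ext_coboundaries_def)
  have Bc: "Ext_cocycles (res_Af f e q B \<epsilon>) (as_Af_mod S) p = hat f e (q p) ` Hom (Qmod e (q p)) S" for p
    using kill2 by (auto simp: Ext_cocycles_def res_Af_def fun_eq_iff HQ)
  show 2: "Ext (res_Af f e q B \<epsilon>) (as_Af_mod S) p = (\<lambda>g. {hat f e (q p) g}) ` Hom (Qmod e (q p)) S"
    by (auto simp: Ext_def Ext_class_def B0 Bc)
  show 3: "ident f e S q B \<epsilon> p {g} = {hat f e (q p) g}" if "g \<in> Hom (Qmod e (q p)) S" for g
    by (auto simp: ident_def Ext_class_def B0)
  show "bij_betw (ident f e S q B \<epsilon> p) (Ext (res_A e q B \<epsilon>) S p)
           (Ext (res_Af f e q B \<epsilon>) (as_Af_mod S) p)"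
    unfolding bij_betw_def 1 2
  proof
    show "inj_on (ident f e S q B \<epsilon> p) ((\<lambda>g. {g}) ` Hom (Qmod e (q p)) S)"
      using hat_inj[of f e "q p" S] 3 by (auto simp: inj_on_def)
    show "ident f e S q B \<epsilon> p ` (\<lambda>g. {g}) ` Hom (Qmod e (q p)) S = (\<lambda>g. {hat f e (q p) g}) ` Hom (Qmod e (q p)) S"
      using 3 by (auto simp: image_iff)
  qed
qed

end

theory Submission
  imports Defs
begin

text \<open>
  An \<open>A\<^sub>f\<close>-linear map between lifted projectives is a triple \<open>(u, s, u)\<close>, and \<open>(0, h, 0)\<close> composed
  with it is \<open>(0, h u, 0)\<close>: a cocycle only sees the diagonal part \<open>u\<close>. So let \<open>\<gamma>\<^sub>j = (u\<^sub>j, s\<^sub>j,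
  u\<^sub>j)\<close> be any lifting of \<open>(0, g, 0)\<close> to the resolution over \<open>A\<^sub>f\<close>, whose differentials are \<open>(0,
  \<delta>, 0)\<close> in even and \<open>(\<delta>, T, \<delta>)\<close> in odd degrees.

  If \<open>p\<close> is even, every square involves two differentials of the same kind and contains the
  equation \<open>\<delta> u\<^sub>j\<^sub>+\<^sub>1 = u\<^sub>j \<delta>\<close>, so \<open>u\<close> lifts \<open>g\<close> over \<open>A\<close>. If \<open>p\<close> is odd, each square mixes the
  two kinds. For even \<open>j\<close> it gives \<open>\<delta> u\<^sub>j\<^sub>+\<^sub>1 = 0\<close> and \<open>T u\<^sub>j\<^sub>+\<^sub>1 + \<delta> s\<^sub>j\<^sub>+\<^sub>1 = u\<^sub>j \<delta>\<close>, whence, by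
  the preceding square, \<open>\<delta> T u\<^sub>j\<^sub>+\<^sub>1 = 0\<close>, and the injectivity half of (*B) yields \<open>u\<^sub>j\<^sub>+\<^sub>1 = 0\<close>.
  What is left of the squares says that \<open>u\<^sub>0, s\<^sub>1, u\<^sub>2, s\<^sub>3, \<dots>\<close> lifts \<open>g\<close> over \<open>A\<close>
  (\<open>restricted_lifting\<close>). The product with \<open>(0, h, 0)\<close> is therefore \<open>h u\<^sub>m\<close>, which is \<open>0\<close> for odd
  \<open>m\<close> and \<open>p\<close>, and represents the product over \<open>A\<close> otherwise (\<open>hat_product\<close>).

  For the products to be well defined, liftings over \<open>A\<^sub>f\<close> must exist and the product must not
  depend on the choice. Existence is the comparison theorem. It needs the lifted projectives to be
  projective (\<open>dual_basis_Qhat\<close>) and the lifted complex to be exact; exactness in odd degrees is the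
  injectivity in (*B), and exactness in even degrees is the decomposition in (*B). Independence need
  only be known over \<open>A\<close>, since every lifting over \<open>A\<^sub>f\<close> restricts to one over \<open>A\<close>; there it follows
  from null-homotopy of liftings of \<open>0\<close> and minimality (\<open>lifting_zero_comp\<close>).
\<close>


section \<open>Homomorphisms of modules\<close>

lemma HomI:
  assumes "\<And>x. x \<in> carr M \<Longrightarrow> u x \<in> carr N"
    and "\<And>x y. x \<in> carr M \<Longrightarrow> y \<in> carr M \<Longrightarrow> u (x + y) = u x + u y"
    and "\<And>a x. x \<in> carr M \<Longrightarrow> u (act M a x) = act N a (u x)"
    and "\<And>x. x \<notin> carr M \<Longrightarrow> u x = 0"
  shows "u \<in> Hom M N"
  using assms by (simp add: Hom_def)

lemma HomD:
  assumes "u \<in> Hom M N"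
  shows "x \<in> carr M \<Longrightarrow> u x \<in> carr N"
    and "x \<in> carr M \<Longrightarrow> y \<in> carr M \<Longrightarrow> u (x + y) = u x + u y"
    and "x \<in> carr M \<Longrightarrow> u (act M a x) = act N a (u x)"
    and "x \<notin> carr M \<Longrightarrow> u x = 0"
  using assms by (simp_all add: Hom_def)

lemma Hom_mem:
  assumes "u \<in> Hom M N" "left_module mul one N"
  shows "u x \<in> carr N"
  using HomD(1,4)[OF assms(1), of x] left_moduleD(1)[OF assms(2)] by metis

lemma left_module_act:
  assumes "left_module mul one M" "x \<in> carr M"
  shows "y \<in> carr M \<Longrightarrow> act M a (x + y) = act M a x + act M a y"
    and "act M (a + b) x = act M a x + act M b x"
    and "act M (mul a b) x = act M a (act M b x)"
    and "act M one x = x"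
  using assms by (simp_all add: left_module_def)

lemma zero_Hom:
  assumes "left_module mul one N"
  shows "0 \<in> Hom M N"
  using left_moduleD(1,5)[OF assms] by (intro HomI) simp_all

lemma Hom_comp:
  assumes "u \<in> Hom L M" "v \<in> Hom M N"
  shows "v \<circ> u \<in> Hom L N"
  using HomD[OF assms(1)] HomD[OF assms(2)] Hom_zero[OF assms(2)] by (intro HomI) auto

lemma Hom_minus:
  assumes "left_module mul one N" "u \<in> Hom M N" "v \<in> Hom M N"
  shows "u - v \<in> Hom M N"
proof (rule HomI)
  fix a x assume x: "x \<in> carr M"
  have "u x - v x \<in> carr N"
    using x HomD(1) assms left_moduleD(2) by metis
  then have "act N a (u x - v x + v x) = act N a (u x - v x) + act N a (v x)"
    using left_module_act(1)[OF assms(1)] HomD(1)[OF assms(3) x] by blast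
  then show "(u - v) (act M a x) = act N a ((u - v) x)"
    using x HomD(3)[OF assms(2) x] HomD(3)[OF assms(3) x] by (simp add: algebra_simps)
qed (use HomD[OF assms(2)] HomD[OF assms(3)] left_moduleD(2)[OF assms(1)] in auto)

lemma module_sum:
  fixes k :: nat
  assumes "left_module mul one M" "\<And>i. i < k \<Longrightarrow> y i \<in> carr M"
  shows "(\<Sum>i<k. y i) \<in> carr M"
    and "act M a (\<Sum>i<k. y i) = (\<Sum>i<k. act M a (y i))"
    and "u \<in> Hom M N \<Longrightarrow> u (\<Sum>i<k. y i) = (\<Sum>i<k. u (y i))"
proof -
  have "(\<Sum>i<k. y i) \<in> carr M \<and> act M a (\<Sum>i<k. y i) = (\<Sum>i<k. act M a (y i)) \<and>
      (u \<in> Hom M N \<longrightarrow> u (\<Sum>i<k. y i) = (\<Sum>i<k. u (y i)))"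
    using assms(2)
  proof (induction k)
    case 0
    then show ?case using left_moduleD(1,5)[OF assms(1)] Hom_zero by auto
  next
    case (Suc k)
    then show ?case
      using left_moduleD(3)[OF assms(1)] left_module_act(1)[OF assms(1)] HomD(2)[of u M N] by auto
  qed
  then show "(\<Sum>i<k. y i) \<in> carr M" "act M a (\<Sum>i<k. y i) = (\<Sum>i<k. act M a (y i))"
    "u \<in> Hom M N \<Longrightarrow> u (\<Sum>i<k. y i) = (\<Sum>i<k. u (y i))" by blast+
qed


section \<open>Projectivity by a dual basis\<close>

definition dual_basis ::
  "('r \<Rightarrow> 'r \<Rightarrow> 'r) \<Rightarrow> ('r::ab_group_add, 'm::ab_group_add) lmod \<Rightarrow> nat \<Rightarrow>
     (nat \<Rightarrow> 'm) \<Rightarrow> (nat \<Rightarrow> 'm \<Rightarrow> 'r) \<Rightarrow> bool" where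
  "dual_basis mul M k b c \<longleftrightarrow>
     (\<forall>i<k. b i \<in> carr M) \<and>
     (\<forall>i<k. \<forall>x\<in>carr M. \<forall>y\<in>carr M. c i (x + y) = c i x + c i y) \<and>
     (\<forall>i<k. \<forall>a. \<forall>x\<in>carr M. c i (act M a x) = mul a (c i x)) \<and>
     (\<forall>x\<in>carr M. (\<Sum>i<k. act M (c i x) (b i)) = x)"

text \<open>
  A module with a finite dual basis is projective: a lift is determined by lifting the images of
  the \<open>b i\<close> and extending with the coordinate functionals.
\<close>

lemma dual_basis_lift:
  assumes M: "left_module mul one M" and N: "left_module mul one N"
    and db: "dual_basis mul M k b c"
    and \<phi>: "\<phi> \<in> Hom M L" and \<pi>: "\<pi> \<in> Hom N L"
    and im: "\<And>x. x \<in> carr M \<Longrightarrow> \<phi> x \<in> \<pi> ` carr N"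
  shows "\<exists>\<psi>\<in>Hom M N. \<pi> \<circ> \<psi> = \<phi>"
proof -
  have b: "b i \<in> carr M" if "i < k" for i using db that by (simp add: dual_basis_def)
  have "\<forall>i. \<exists>y. i < k \<longrightarrow> y \<in> carr N \<and> \<pi> y = \<phi> (b i)" using im b by (metis imageE)
  then obtain y where y: "\<And>i. i < k \<Longrightarrow> y i \<in> carr N" "\<And>i. i < k \<Longrightarrow> \<pi> (y i) = \<phi> (b i)"
    by metis
  define \<psi> where "\<psi> = zext (carr M) (\<lambda>x. \<Sum>i<k. act N (c i x) (y i))"
  have ay: "act N a (y i) \<in> carr N" if "i < k" for a i using left_moduleD(4)[OF N y(1)[OF that]] .
  have "\<psi> \<in> Hom M N"
  proof (rule HomI)
    fix x assume x: "x \<in> carr M"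
    then show "\<psi> x \<in> carr N" using module_sum(1)[OF N, of k "\<lambda>i. act N (c i x) (y i)"] ay
      by (simp add: \<psi>_def zext_def)
    show "\<psi> (x + z) = \<psi> x + \<psi> z" if z: "z \<in> carr M" for z
      using x z left_moduleD(3)[OF M x z] db left_module_act(2)[OF N y(1)]
      by (simp add: \<psi>_def zext_def dual_basis_def flip: sum.distrib)
    show "\<psi> (act M a x) = act N a (\<psi> x)" for a
    proof -
      have "(\<Sum>i<k. act N (c i (act M a x)) (y i)) = (\<Sum>i<k. act N a (act N (c i x) (y i)))"
        using x db left_module_act(3)[OF N y(1)] by (simp add: dual_basis_def)
      then show ?thesis
        using x left_moduleD(4)[OF M x] module_sum(2)[OF N ay] by (simp add: \<psi>_def zext_def)
    qed
  qed (simp add: \<psi>_def zext_def)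
  moreover have "\<pi> (\<psi> x) = \<phi> x" for x
  proof (cases "x \<in> carr M")
    case True
    have "\<pi> (\<psi> x) = (\<Sum>i<k. act L (c i x) (\<phi> (b i)))"
      using True module_sum(3)[OF N ay \<pi>] HomD(3)[OF \<pi> y(1)] y(2) by (simp add: \<psi>_def zext_def)
    also have "\<dots> = \<phi> (\<Sum>i<k. act M (c i x) (b i))"
      using module_sum(3)[OF M left_moduleD(4)[OF M b] \<phi>] HomD(3)[OF \<phi> b] by simp
    also have "\<dots> = \<phi> x" using db True by (simp add: dual_basis_def)
    finally show ?thesis .
  next
    case False
    then show ?thesis using Hom_zero[OF \<pi>] HomD(4)[OF \<phi>] by (simp add: \<psi>_def zext_def)
  qed
  ultimately show ?thesis by (auto simp: fun_eq_iff)
qed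


section \<open>Comparison of projective resolutions\<close>

locale projective_resolution =
  fixes mul :: "'r::ab_group_add \<Rightarrow> 'r \<Rightarrow> 'r" and one :: 'r
    and R :: "('r, 'm::ab_group_add, 's::ab_group_add) resolution" and M :: "('r, 's) lmod"
  assumes module: "left_module mul one (obj R i)"
    and projective: "\<exists>k b c. dual_basis mul (obj R i) k b c"
    and aug_Hom: "aug R \<in> Hom (obj R 0) M"
    and aug_onto: "aug R ` carr (obj R 0) = carr M"
    and bd_Hom: "bd R (Suc i) \<in> Hom (obj R (Suc i)) (obj R i)"
    and exact_0: "ker_on (obj R 0) (aug R) = bd R (Suc 0) ` carr (obj R (Suc 0))"
    and exact_Suc: "ker_on (obj R (Suc i)) (bd R (Suc i))
                     = bd R (Suc (Suc i)) ` carr (obj R (Suc (Suc i)))"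
begin

lemma lift_through:
  assumes "left_module mul one N" "\<phi> \<in> Hom (obj R i) L" "\<pi> \<in> Hom N L"
    and "\<And>x. x \<in> carr (obj R i) \<Longrightarrow> \<phi> x \<in> \<pi> ` carr N"
  shows "\<exists>\<psi>\<in>Hom (obj R i) N. \<pi> \<circ> \<psi> = \<phi>"
  using projective[of i] dual_basis_lift[OF module assms(1) _ assms(2,3,4)] by blast

lemma bd_bd: "bd R (Suc i) (bd R (Suc (Suc i)) x) = 0"
proof (cases "x \<in> carr (obj R (Suc (Suc i)))")
  case True
  then show ?thesis using exact_Suc[of i] by (auto simp: ker_on_def)
next
  case False
  then show ?thesis using HomD(4)[OF bd_Hom] Hom_zero[OF bd_Hom] by simp
qed

lemma aug_bd: "aug R (bd R (Suc 0) x) = 0"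
proof (cases "x \<in> carr (obj R (Suc 0))")
  case True
  then show ?thesis using exact_0 by (auto simp: ker_on_def)
next
  case False
  then show ?thesis using HomD(4)[OF bd_Hom] Hom_zero[OF aug_Hom] by simp
qed

lemma lifting_exists:
  assumes g: "g \<in> Hom (obj R p) M" and g0: "g \<circ> bd R (Suc p) = 0"
  shows "\<exists>\<gamma>. lifting R p g \<gamma>"
proof -
  \<comment> \<open>The last condition says that \<open>\<gamma>\<close> can be continued by one more square.\<close>
  define ok where "ok j \<gamma> \<longleftrightarrow> \<gamma> \<in> Hom (obj R (p + j)) (obj R j) \<and> (j = 0 \<longrightarrow> aug R \<circ> \<gamma> = g) \<and>
      (\<forall>x. \<gamma> (bd R (Suc (p + j)) x) \<in> bd R (Suc j) ` carr (obj R (Suc j)))" for j \<gamma>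
  define next_ok where "next_ok j \<gamma> \<gamma>' \<longleftrightarrow> bd R (Suc j) \<circ> \<gamma>' = \<gamma> \<circ> bd R (Suc (p + j))" for j \<gamma> \<gamma>'
  have "\<exists>\<gamma>. ok 0 \<gamma>"
  proof -
    obtain \<gamma> where \<gamma>: "\<gamma> \<in> Hom (obj R p) (obj R 0)" "aug R \<circ> \<gamma> = g"
      using lift_through[OF module g aug_Hom] HomD(1)[OF g] aug_onto by auto
    have "\<gamma> (bd R (Suc p) x) \<in> ker_on (obj R 0) (aug R)" for x
      using Hom_mem[OF \<gamma>(1) module] fun_cong[OF \<gamma>(2)] fun_cong[OF g0] by (simp add: ker_on_def)
    then show ?thesis using \<gamma> exact_0 by (auto simp: ok_def)
  qed
  moreover have "\<exists>\<gamma>'. ok (Suc j) \<gamma>' \<and> next_ok j \<gamma> \<gamma>'" if "ok j \<gamma>" for j \<gamma>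
  proof -
    have \<gamma>: "\<gamma> \<in> Hom (obj R (p + j)) (obj R j)"
      "\<And>x. \<gamma> (bd R (Suc (p + j)) x) \<in> bd R (Suc j) ` carr (obj R (Suc j))"
      using that by (auto simp: ok_def)
    obtain \<gamma>' where \<gamma>': "\<gamma>' \<in> Hom (obj R (Suc (p + j))) (obj R (Suc j))"
      "bd R (Suc j) \<circ> \<gamma>' = \<gamma> \<circ> bd R (Suc (p + j))"
      using lift_through[OF module Hom_comp[OF bd_Hom \<gamma>(1)] bd_Hom] \<gamma>(2) by (metis comp_apply)
    have "\<gamma>' (bd R (Suc (Suc (p + j))) x) \<in> ker_on (obj R (Suc j)) (bd R (Suc j))" for x
      using Hom_mem[OF \<gamma>'(1) module] fun_cong[OF \<gamma>'(2), of "bd R (Suc (Suc (p + j))) x"]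
        bd_bd Hom_zero[OF \<gamma>(1)] by (simp add: ker_on_def)
    then show ?thesis using \<gamma>' exact_Suc by (auto simp: ok_def next_ok_def)
  qed
  ultimately obtain \<gamma> where "\<forall>j. ok j (\<gamma> j)" "\<forall>j. next_ok j (\<gamma> j) (\<gamma> (Suc j))"
    using dependent_nat_choice[of ok next_ok] by blast
  then have "lifting R p g \<gamma>" by (simp add: lifting_def ok_def next_ok_def)
  then show ?thesis by blast
qed

text \<open>
  A chain map lifting \<open>0\<close> is null-homotopic, so that \<open>\<gamma> m = bd R (Suc m) \<circ> \<sigma> + \<tau>\<close>, where \<open>\<tau>\<close> is \<open>0\<close>
  for \<open>m = 0\<close> and otherwise \<open>\<sigma>' \<circ> bd R (p + m)\<close> with the previous homotopy \<open>\<sigma>'\<close>. Minimality says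
  that homomorphisms to \<open>N\<close> vanish on boundaries, so they kill both summands.
\<close>

lemma lifting_zero_comp:
  assumes lift: "lifting R p 0 \<gamma>"
    and minimal: "\<And>j h. h \<in> Hom (obj R j) N \<Longrightarrow> h \<circ> bd R (Suc j) = 0"
    and h: "h \<in> Hom (obj R m) N"
  shows "h \<circ> \<gamma> m = 0"
proof -
  have \<gamma>: "\<gamma> j \<in> Hom (obj R (p + j)) (obj R j)" for j using lift by (simp add: lifting_def)
  have sq: "bd R (Suc j) (\<gamma> (Suc j) x) = \<gamma> j (bd R (Suc (p + j)) x)" for j x
    using lift by (auto simp: lifting_def fun_eq_iff)
  have ag: "aug R (\<gamma> 0 x) = 0" for x
    using lift by (auto simp: lifting_def fun_eq_iff)
  \<comment> \<open>Recording only what the next step needs of \<open>\<tau>\<close> makes one homotopy at a time suffice.\<close>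
  have "\<exists>\<sigma>\<in>Hom (obj R (p + m)) (obj R (Suc m)). \<exists>\<tau>.
      (\<forall>x. \<gamma> m x = bd R (Suc m) (\<sigma> x) + \<tau> x) \<and> (\<forall>x. \<tau> x \<in> carr (obj R m)) \<and>
      (\<forall>x. \<tau> (bd R (Suc (p + m)) x) = 0) \<and> (\<forall>h\<in>Hom (obj R m) N. \<forall>x. h (\<tau> x) = 0)"
  proof (induction m)
    case 0
    have "\<gamma> 0 x \<in> bd R (Suc 0) ` carr (obj R (Suc 0))" for x
      using ag Hom_mem[OF \<gamma> module, of 0] exact_0 by (auto simp: ker_on_def)
    then obtain \<sigma> where \<sigma>: "\<sigma> \<in> Hom (obj R (p + 0)) (obj R (Suc 0))" "bd R (Suc 0) \<circ> \<sigma> = \<gamma> 0"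
      using lift_through[OF module \<gamma>[of 0] bd_Hom] by blast
    then show ?case
      using left_moduleD(1)[OF module[of 0]] Hom_zero
      by (intro bexI[of _ \<sigma>] exI[of _ "\<lambda>_. 0"]) (auto simp flip: \<sigma>(2))
  next
    case (Suc m)
    then obtain \<sigma> \<tau> where \<sigma>: "\<sigma> \<in> Hom (obj R (p + m)) (obj R (Suc m))"
      and dec: "\<And>x. \<gamma> m x = bd R (Suc m) (\<sigma> x) + \<tau> x" and \<tau>: "\<And>x. \<tau> (bd R (Suc (p + m)) x) = 0"
      by blast
    define \<tau>' where "\<tau>' = \<sigma> \<circ> bd R (Suc (p + m))"
    have \<tau>'H: "\<tau>' \<in> Hom (obj R (Suc (p + m))) (obj R (Suc m))"
      unfolding \<tau>'_def by (rule Hom_comp[OF bd_Hom \<sigma>])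
    have \<gamma>': "\<gamma> (Suc m) \<in> Hom (obj R (Suc (p + m))) (obj R (Suc m))" using \<gamma>[of "Suc m"] by simp
    define \<phi> where "\<phi> = \<gamma> (Suc m) - \<tau>'"
    have \<phi>: "\<phi> \<in> Hom (obj R (Suc (p + m))) (obj R (Suc m))"
      unfolding \<phi>_def by (rule Hom_minus[OF module \<gamma>' \<tau>'H])
    have "bd R (Suc m) (\<phi> x) = 0" for x
      using Hom_diff[OF bd_Hom module Hom_mem[OF \<gamma>' module] Hom_mem[OF \<tau>'H module], of x x] sq[of m x]
        dec \<tau> by (simp add: \<phi>_def \<tau>'_def)
    then have "\<phi> x \<in> bd R (Suc (Suc m)) ` carr (obj R (Suc (Suc m)))" for x
      using Hom_mem[OF \<phi> module] exact_Suc[of m] by (auto simp: ker_on_def)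
    then obtain \<sigma>' where \<sigma>': "\<sigma>' \<in> Hom (obj R (Suc (p + m))) (obj R (Suc (Suc m)))"
      "bd R (Suc (Suc m)) \<circ> \<sigma>' = \<phi>"
      using lift_through[OF module \<phi> bd_Hom] by blast
    have "\<gamma> (Suc m) x = bd R (Suc (Suc m)) (\<sigma>' x) + \<tau>' x" for x
      using fun_cong[OF \<sigma>'(2), of x] by (simp add: \<phi>_def)
    moreover have "\<tau>' (bd R (Suc (p + Suc m)) x) = 0" for x
      using bd_bd Hom_zero[OF \<sigma>] by (simp add: \<tau>'_def)
    moreover have "h (\<tau>' x) = 0" if "h \<in> Hom (obj R (Suc m)) N" for h x
      using fun_cong[OF minimal[OF Hom_comp[OF \<sigma> that]], of x] by (simp add: \<tau>'_def)
    moreover have "\<tau>' x \<in> carr (obj R (Suc m))" for x using Hom_mem[OF \<tau>'H module] .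
    ultimately show ?case
      using \<sigma>'(1) by (intro bexI[of _ \<sigma>'] exI[of _ \<tau>']) simp_all
  qed
  then obtain \<sigma> \<tau> where \<sigma>: "\<sigma> \<in> Hom (obj R (p + m)) (obj R (Suc m))"
    and dec: "\<And>x. \<gamma> m x = bd R (Suc m) (\<sigma> x) + \<tau> x" and \<tau>: "\<And>x. \<tau> x \<in> carr (obj R m)"
    and h\<tau>: "\<And>x. h (\<tau> x) = 0"
    using h by blast
  have "h (\<gamma> m x) = 0" for x
    using HomD(2)[OF h Hom_mem[OF bd_Hom module] \<tau>] fun_cong[OF minimal[OF h]] h\<tau> by (simp add: dec)
  then show ?thesis by (simp add: fun_eq_iff)
qed

text \<open>The difference of two liftings of \<open>g\<close> lifts \<open>0\<close>.\<close>

lemma lifting_comp_unique: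
  assumes \<gamma>: "lifting R p g \<gamma>" and \<gamma>': "lifting R p g \<gamma>'"
    and minimal: "\<And>j h. h \<in> Hom (obj R j) N \<Longrightarrow> h \<circ> bd R (Suc j) = 0"
    and h: "h \<in> Hom (obj R m) N"
  shows "h \<circ> \<gamma> m = h \<circ> \<gamma>' m"
proof -
  have H: "\<gamma> j \<in> Hom (obj R (p + j)) (obj R j)" "\<gamma>' j \<in> Hom (obj R (p + j)) (obj R j)" for j
    using \<gamma> \<gamma>' by (simp_all add: lifting_def)
  have diff: "u (\<gamma> j x - \<gamma>' j x) = u (\<gamma> j x) - u (\<gamma>' j x)" if "u \<in> Hom (obj R j) L"
    for u j x and L :: "('r, 't::ab_group_add) lmod"
    using Hom_diff[OF that module Hom_mem[OF H(1) module] Hom_mem[OF H(2) module]] .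
  have "lifting R p 0 (\<lambda>j. \<gamma> j - \<gamma>' j)"
    using \<gamma> \<gamma>' Hom_minus[OF module H] diff[OF aug_Hom] diff[OF bd_Hom]
    by (simp add: lifting_def fun_eq_iff)
  from lifting_zero_comp[OF this minimal h] show ?thesis
    using diff[OF h] by (simp add: fun_eq_iff)
qed

end


text \<open>The coboundaries form the class of \<open>0\<close>, which contains \<open>0\<close> and has one element.\<close>

lemma coboundaries_trivial:
  assumes N: "left_module mul one N"
    and singletons: "\<And>Z. Z \<in> Ext R N p \<Longrightarrow> \<exists>g. Z = {g}"
  shows "Ext_coboundaries R N p = {0}"
proof -
  have mem: "0 \<in> Ext_coboundaries R N p"
    using zero_Hom[OF N] by (auto simp: Ext_coboundaries_def fun_eq_iff split: nat.split intro!: exI[of _ 0])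
  have "0 \<in> Ext_cocycles R N p"
    using zero_Hom[OF N] by (simp add: Ext_cocycles_def fun_eq_iff)
  then obtain g where "Ext_class R N p 0 = {g}"
    using singletons by (auto simp: Ext_def)
  moreover have "Ext_class R N p 0 = Ext_coboundaries R N p"
    by (simp add: Ext_class_def)
  ultimately show ?thesis using mem by simp
qed


lemma yoneda_singleton:
  assumes "\<exists>\<gamma>. lifting R p g \<gamma>"
    and "\<And>\<gamma>. lifting R p g \<gamma> \<Longrightarrow> Ext_class R N (m + p) (h \<circ> \<gamma> m) = Z"
  shows "yoneda R N m p {h} {g} = Z"
proof -
  obtain \<gamma> where "lifting R p g \<gamma>" using assms(1) ..
  then show ?thesis
    unfolding yoneda_def using assms(2) by (intro the_equality) blast+
qed


section \<open>Dual bases of the projective modules\<close>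

lemma sum_single:
  fixes k r :: nat and F :: "nat \<Rightarrow> 'b::comm_monoid_add"
  assumes "\<And>i. i \<noteq> r \<Longrightarrow> F i = 0"
  shows "(\<Sum>i<k. F i) = (if r < k then F r else 0)"
proof -
  have "(\<Sum>i<k. F i) = (\<Sum>i<k. if i = r then F r else 0)"
    using assms by (intro sum.cong) auto
  then show ?thesis by simp
qed

lemma sum_fun_apply: "(\<Sum>i<k. F i) r = (\<Sum>i<(k::nat). F i r)" for F :: "nat \<Rightarrow> 'c \<Rightarrow> 'b::comm_monoid_add"
  by (induction k) auto

lemma dual_basis_Qmod:
  fixes e :: "nat \<Rightarrow> 'a::ring_1"
  assumes idem: "\<And>j. j \<in> set js \<Longrightarrow> e j * e j = e j"
  shows "dual_basis (*) (Qmod e js) (length js) (\<lambda>i r. if r = i then e (js ! i) else 0) (\<lambda>i x. x i)"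
  unfolding dual_basis_def
proof (intro conjI allI impI ballI)
  fix i assume "i < length js"
  then show "(\<lambda>r. if r = i then e (js ! i) else 0) \<in> carr (Qmod e js)"
    using idem[of "js ! i"] by (auto simp: Qmod_carr_iff image_iff intro: exI[of _ 0] exI[of _ 1])
next
  fix x assume x: "x \<in> carr (Qmod e js)"
  show "(\<Sum>i<length js. act (Qmod e js) (x i) (\<lambda>r. if r = i then e (js ! i) else 0)) = x"
  proof
    fix r
    have "(\<Sum>i<length js. x i * (if r = i then e (js ! i) else 0)) = x r"
      using x Qmod_idem[OF x] idem by (subst sum_single[of r]) (auto simp: Qmod_carr_iff)
    then show "(\<Sum>i<length js. act (Qmod e js) (x i) (\<lambda>r. if r = i then e (js ! i) else 0)) r = x r"
      by (simp add: sum_fun_apply Qmod_def)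
  qed
qed (auto simp: Qmod_def)

text \<open>
  The coordinate functional \<open>x \<mapsto> x\<^sub>i\<close> on \<open>Ae\<^sub>i\<close> becomes \<open>A\<^sub>f\<close>-linear after adding the correction
  \<open>f(x\<^sub>i \<otimes> e\<^sub>i)\<close> to the coefficient of \<open>t\<close>: the cocycle identity gives
  \<open>f(ax \<otimes> e) - a f(x \<otimes> e) = f(a \<otimes> x) - f(a \<otimes> x)e\<close>, which is the difference between the twist
  in \<open>A\<^sub>f\<close> and the twist \<open>f\<^sub>Q\<close>. Correspondingly the generator has second component
  \<open>-2f(e \<otimes> e)e\<close>, because \<open>f(x \<otimes> e)e = x f(e \<otimes> e)\<close> for \<open>x = xe\<close>.
\<close>

lemma dual_basis_Qhat:
  fixes e :: "nat \<Rightarrow> 'a::ring_1"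
  assumes f: "hochschild_2cocycle scale f" and idem: "\<And>j. j \<in> set js \<Longrightarrow> e j * e j = e j"
  shows "dual_basis (Af_mult f) (Qhat f e js) (length js)
     (\<lambda>i. (\<lambda>r. if r = i then e (js ! i) else 0,
          \<lambda>r. if r = i then - (f (e (js ! i)) (e (js ! i)) + f (e (js ! i)) (e (js ! i))) * e (js ! i) else 0))
     (\<lambda>i (x, y). (x i, y i + f (x i) (e (js ! i))))"
    (is "dual_basis _ _ _ (\<lambda>i. (?b i, ?b' i)) ?c")
proof -
  note C = cocycleD[OF f]
  have id: "e (js ! i) * e (js ! i) = e (js ! i)" if "i < length js" for i
    using idem that by simp
  have xe: "x i * e (js ! i) = x i" if "x \<in> carr (Qmod e js)" "i < length js" for x i
    using Qmod_idem[OF that id[OF that(2)]] .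
  have corr: "f (x i) (e (js ! i)) * e (js ! i) = x i * f (e (js ! i)) (e (js ! i))"
    if "x \<in> carr (Qmod e js)" "i < length js" for x i
    using C(7)[of "x i" "e (js ! i)" "e (js ! i)"] xe[OF that] id[OF that(2)] by simp
  show ?thesis
    unfolding dual_basis_def
  proof (intro conjI allI impI ballI)
    fix i assume i: "i < length js"
    have "e (js ! i) \<in> range (\<lambda>a. a * e (js ! i))" using id[OF i] by (metis rangeI)
    then show "(?b i, ?b' i) \<in> carr (Qhat f e js)"
      using i by (auto simp: Qhat_simps Qmod_carr_iff intro: rev_image_eqI[where x=0])
  next
    fix i and a :: "'a \<times> 'a" and z assume i: "i < length js" and z: "z \<in> carr (Qhat f e js)"
    obtain a0 a1 x y where [simp]: "a = (a0, a1)" "z = (x, y)" by (cases a; cases z)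
    have "x i * e (js ! i) = x i" using z xe i by (auto simp: Qhat_simps)
    then have "f (a0 * x i) (e (js ! i)) = a0 * f (x i) (e (js ! i)) + f a0 (x i) - f a0 (x i) * e (js ! i)"
      using C(7)[of a0 "x i" "e (js ! i)"] by (simp add: algebra_simps)
    then show "?c i (act (Qhat f e js) a z) = Af_mult f a (?c i z)"
      using i by (simp add: Qhat_simps Af_mult_def f_Q_def algebra_simps)
  next
    fix z assume z: "z \<in> carr (Qhat f e js)"
    obtain x y where [simp]: "z = (x, y)" by (cases z)
    have x: "x \<in> carr (Qmod e js)" and y: "y \<in> carr (Qmod e js)" using z by (auto simp: Qhat_simps)
    have ev: "act (Qhat f e js) (?c i z) (?b i, ?b' i) = (\<lambda>r. if r = i then x i else 0, \<lambda>r. if r = i then y i else 0)"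
      if i: "i < length js" for i
    proof -
      have corr': "x i * f (e (js ! i)) (e (js ! i)) * e (js ! i) = x i * f (e (js ! i)) (e (js ! i))"
        using corr[OF x i] id[OF i] by (metis mult.assoc)
      show ?thesis
        using i xe[OF x i] xe[OF y i] corr[OF x i] corr' id[OF i] C(4)
        by (auto simp: Qhat_simps f_Q_def fun_eq_iff algebra_simps simp flip: mult.assoc)
    qed
    have sel: "(\<Sum>i<length js. (\<lambda>r. if r = i then w i else 0)) = w" if "w \<in> carr (Qmod e js)" for w
    proof
      fix r
      show "(\<Sum>i<length js. (\<lambda>r. if r = i then w i else 0)) r = w r"
        unfolding sum_fun_apply using that by (subst sum_single[of r]) (auto simp: Qmod_carr_iff)
    qed
    show "(\<Sum>i<length js. act (Qhat f e js) (?c i z) (?b i, ?b' i)) = z"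
      using ev sel[OF x] sel[OF y] by (simp add: prod_eq_iff fst_sum snd_sum)
  qed (auto simp: C algebra_simps)
qed

section \<open>Homomorphisms between the lifted projectives\<close>

text \<open>
  Every \<open>A\<^sub>f\<close>-linear map between lifted projectives is a triple \<open>(u\<^sub>0, u\<^sub>1, u\<^sub>0)\<close>: the action of \<open>t\<close>
  is \<open>(x, y) \<mapsto> (0, x)\<close>, so it transports the first component to the third.
\<close>

definition top_part :: "('m::zero \<times> 'm \<Rightarrow> 'n \<times> 'n) \<Rightarrow> 'm \<Rightarrow> 'n" where
  "top_part u = (\<lambda>x. fst (u (x, 0)))"

definition low_part :: "('m::zero \<times> 'm \<Rightarrow> 'n \<times> 'n) \<Rightarrow> 'm \<Rightarrow> 'n" where
  "low_part u = (\<lambda>x. snd (u (x, 0)))"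

lemma Hom_Qhat_parts:
  fixes f :: "'a::ring_1 \<Rightarrow> 'a \<Rightarrow> 'a"
  assumes f: "hochschild_2cocycle scale f" and u: "u \<in> Hom (Qhat f e js) (Qhat f e js')"
  shows "top_part u \<in> Hom (Qmod e js) (Qmod e js')"
    and "\<And>x y. x \<in> carr (Qmod e js) \<Longrightarrow> y \<in> carr (Qmod e js) \<Longrightarrow>
           u (x, y) = (top_part u x, low_part u x + top_part u y)"
    and "top_part u = 0 \<Longrightarrow> low_part u \<in> Hom (Qmod e js) (Qmod e js')"
proof -
  note C = cocycleD[OF f]
  let ?C = "carr (Qmod e js)"
  have Q: "act (Qmod e js) = (\<lambda>a x r. a * x r)" for js by (simp add: Qmod_def)
  note Qc = left_moduleD[OF left_module_Qmod[of e js]]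
  have mem: "fst (u (x, 0)) \<in> carr (Qmod e js')" "snd (u (x, 0)) \<in> carr (Qmod e js')" if "x \<in> ?C" for x
    using HomD(1)[OF u, of "(x, 0)"] that Qc(1) by (auto simp: Qhat_simps)
  have t: "u (0, x) = (0, top_part u x)" if x: "x \<in> ?C" for x
  proof -
    have t: "act (Qhat f e js) (0, 1) (x, y) = (0, x)" for js x y
      by (auto simp: Qhat_simps f_Q_def C fun_eq_iff)
    have "u (act (Qhat f e js) (0, 1) (x, 0)) = act (Qhat f e js') (0, 1) (u (x, 0))"
      by (rule HomD(3)[OF u]) (use x Qc(1) in \<open>simp add: Qhat_simps\<close>)
    then show ?thesis by (cases "u (x, 0)") (simp add: t top_part_def)
  qed
  show dec: "u (x, y) = (top_part u x, low_part u x + top_part u y)" if "x \<in> ?C" "y \<in> ?C" for x y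
    using HomD(2)[OF u, of "(x, 0)" "(0, y)"] that Qc(1) t[OF that(2)]
    by (cases "u (x, 0)") (simp add: Qhat_simps top_part_def low_part_def)
  have add: "top_part u (x + y) = top_part u x + top_part u y"
    "low_part u (x + y) = low_part u x + low_part u y" if "x \<in> ?C" "y \<in> ?C" for x y
    using HomD(2)[OF u, of "(x, 0)" "(y, 0)"] that Qc(1)
    by (simp_all add: Qhat_simps top_part_def low_part_def)
  have act: "top_part u (act (Qmod e js) a x) = act (Qmod e js') a (top_part u x) \<and>
      low_part u (act (Qmod e js) a x) + top_part u (f_Q f e js a x)
        = act (Qmod e js') a (low_part u x) + f_Q f e js' a (top_part u x)" if x: "x \<in> ?C" for a x
  proof -
    have *: "act (Qhat f e js) (a, 0) (x, 0) = (act (Qmod e js) a x, f_Q f e js a x)"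
      by (auto simp: Qhat_simps Q fun_eq_iff)
    have "u (act (Qhat f e js) (a, 0) (x, 0)) = act (Qhat f e js') (a, 0) (u (x, 0))"
      by (rule HomD(3)[OF u]) (use x Qc(1) in \<open>simp add: Qhat_simps\<close>)
    then show ?thesis
      unfolding * dec[OF Qc(4)[OF x] f_Q_mem]
      by (cases "u (x, 0)") (auto simp: Qhat_simps Q top_part_def low_part_def fun_eq_iff)
  qed
  have out: "top_part u x = 0" "low_part u x = 0" if "x \<notin> ?C" for x
    using HomD(4)[OF u, of "(x, 0)"] that by (simp_all add: Qhat_simps top_part_def low_part_def)
  show T: "top_part u \<in> Hom (Qmod e js) (Qmod e js')"
    by (rule HomI) (use mem add act out in \<open>simp_all add: top_part_def\<close>)
  assume 0: "top_part u = 0"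
  have fQ: "f_Q f e js' a 0 = 0" for a by (auto simp: f_Q_def C fun_eq_iff)
  show "low_part u \<in> Hom (Qmod e js) (Qmod e js')"
    by (rule HomI) (use mem add act out 0 fQ in \<open>simp_all add: low_part_def\<close>)
qed

lemma hat_apply:
  assumes "x \<in> carr (Qmod e js)" "y \<in> carr (Qmod e js)"
  shows "hat f e js g (x, y) = (0, g x)"
  using assms by (simp add: hat_def triple_map_def zext_def Qhat_simps)

text \<open>In terms of triples, \<open>(0, g, 0)(u\<^sub>0, u\<^sub>1, u\<^sub>0) = (0, g u\<^sub>0, 0)\<close>.\<close>

lemma hat_comp:
  fixes f :: "'a::ring_1 \<Rightarrow> 'a \<Rightarrow> 'a"
  assumes f: "hochschild_2cocycle scale f" and u: "u \<in> Hom (Qhat f e js) (Qhat f e js')"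
    and g: "g \<in> Hom (Qmod e js') S" and S: "left_module (*) 1 S"
  shows "hat f e js' g \<circ> u = hat f e js (g \<circ> top_part u)"
proof
  note P = Hom_Qhat_parts[OF f u]
  fix z :: "(nat \<Rightarrow> 'a) \<times> (nat \<Rightarrow> 'a)"
  obtain x y where z: "z = (x, y)" by (cases z)
  show "(hat f e js' g \<circ> u) z = hat f e js (g \<circ> top_part u) z"
  proof (cases "z \<in> carr (Qhat f e js)")
    case True
    then have "x \<in> carr (Qmod e js)" "y \<in> carr (Qmod e js)" by (auto simp: z Qhat_simps)
    then show ?thesis
      using P(2) HomD(1)[OF u True] by (auto simp: z hat_apply Qhat_simps)
  next
    case False
    then show ?thesis
      using HomD(4)[OF u False] Hom_zero[OF g]
      by (simp add: hat_def triple_map_def zext_def zero_prod_def)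
  qed
qed

text \<open>
  This is the relation that makes \<open>(\<delta>, T, \<delta>)\<close> linear over \<open>A\<^sub>f\<close>. It is the cocycle identity for
  \<open>a\<close>, \<open>x\<^sub>l\<close>, \<open>b\<^sub>l\<^sub>s\<close>, summed over \<open>l\<close> and multiplied by \<open>e\<^sub>s\<close> from the right; \<open>E B = B = B E'\<close> matches the
  idempotents.
\<close>

lemma T_of_matrix_twisted:
  assumes f: "hochschild_2cocycle scale f" and B: "is_hom_matrix e js js' B"
    and idem: "\<And>j. j \<in> set js' \<Longrightarrow> e j * e j = e j"
    and x: "x \<in> carr (Qmod e js)"
  shows "T_of_matrix f e js js' B (act (Qmod e js) a x) + hom_of_matrix e js js' B (f_Q f e js a x)
    = act (Qmod e js') a (T_of_matrix f e js js' B x) + f_Q f e js' a (hom_of_matrix e js js' B x)"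
proof
  note C = cocycleD[OF f]
  have Q: "act (Qmod e js) = (\<lambda>a x r. a * x r)" for js by (simp add: Qmod_def)
  have ax: "(\<lambda>r. a * x r) \<in> carr (Qmod e js)"
    using left_moduleD(4)[OF left_module_Qmod x, of a] by (simp add: Q)
  fix s
  have "(\<Sum>l<length js. f (a * x l) (B l s)) * e (js' ! s) +
      (\<Sum>l<length js. f_Q f e js a x l * B l s)
    = a * ((\<Sum>l<length js. f (x l) (B l s)) * e (js' ! s)) + f a (\<Sum>l<length js. x l * B l s) * e (js' ! s)"
    if s: "s < length js'"
  proof -
    have "f (a * x l) (B l s) * e (js' ! s) + f_Q f e js a x l * B l s
        = a * (f (x l) (B l s) * e (js' ! s)) + f a (x l * B l s) * e (js' ! s)"
      if l: "l < length js" for l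
    proof -
      have B1: "e (js ! l) * B l s * e (js' ! s) = B l s"
        using B l s by (simp add: is_hom_matrix_def)
      have "e (js' ! s) * e (js' ! s) = e (js' ! s)" using idem s by simp
      then have B2: "B l s * e (js' ! s) = B l s" using B1 by (metis mult.assoc)
      then have "e (js ! l) * B l s = B l s" using B1 by (simp add: mult.assoc)
      then have fQ: "f_Q f e js a x l * B l s = f a (x l) * B l s * e (js' ! s)"
        using l B2 by (simp add: f_Q_def mult.assoc)
      have "f (a * x l) (B l s) + f a (x l) * B l s = a * f (x l) (B l s) + f a (x l * B l s)"
        using C(7)[of a "x l" "B l s"] by (simp add: algebra_simps)
      then show ?thesis unfolding fQ by (metis (no_types) distrib_right mult.assoc)
    qed
    then show ?thesis
      by (simp add: sum_distrib_left sum_distrib_right C(6) flip: sum.distrib)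
  qed
  then show "(T_of_matrix f e js js' B (act (Qmod e js) a x) + hom_of_matrix e js js' B (f_Q f e js a x)) s
    = (act (Qmod e js') a (T_of_matrix f e js js' B x) + f_Q f e js' a (hom_of_matrix e js js' B x)) s"
    using x ax f_Q_mem[of f e js a x]
    by (simp add: T_of_matrix_def hom_of_matrix_def zext_def Q f_Q_def[of f e js'])
qed

lemma T_of_matrix_add:
  assumes f: "hochschild_2cocycle scale f" and "x \<in> carr (Qmod e js)" "y \<in> carr (Qmod e js)"
  shows "T_of_matrix f e js js' B (x + y) = T_of_matrix f e js js' B x + T_of_matrix f e js js' B y"
  using assms(2,3) left_moduleD(3)[OF left_module_Qmod[of e js]] cocycleD(2)[OF f]
  by (auto simp: T_of_matrix_def zext_def fun_eq_iff sum.distrib distrib_right)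


section \<open>The two resolutions of \<open>S\<close>\<close>

locale star_B =
  fixes scale :: "'k::field \<Rightarrow> 'a::ring_1 \<Rightarrow> 'a"
    and f :: "'a \<Rightarrow> 'a \<Rightarrow> 'a"
    and n :: nat and e :: "nat \<Rightarrow> 'a"
    and S :: "('a, 's::ab_group_add) lmod"
    and q :: "nat \<Rightarrow> nat list" and B :: "nat \<Rightarrow> nat \<Rightarrow> nat \<Rightarrow> 'a"
    and \<epsilon> :: "(nat \<Rightarrow> 'a) \<Rightarrow> 's"
  assumes cocycle: "hochschild_2cocycle scale f"
    and idempotents: "basic_idempotents n e"
    and simples: "sum_of_simples n e S"
    and star: "star_B_resolution f n e S q B \<epsilon>"
begin

abbreviation Q where "Q i \<equiv> Qmod e (q i)"
abbreviation d where "d \<equiv> \<delta> e q B"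
abbreviation T where "T \<equiv> T\<delta> f e q B"
abbreviation RA where "RA \<equiv> res_A e q B \<epsilon>"
abbreviation Rf where "Rf \<equiv> res_Af f e q B \<epsilon>"

lemma minimal: "minimal_projective_resolution n e S q B \<epsilon>"
  using star by (simp add: star_B_resolution_def)

lemma module_S: "left_module (*) 1 S"
  using simples by (simp add: sum_of_simples_def)

lemma idem: "j \<in> set (q i) \<Longrightarrow> e j * e j = e j"
  using minimal basic_idem[OF idempotents] by (auto simp: minimal_projective_resolution_def)

lemma hom_matrix: "is_hom_matrix e (q (Suc i)) (q i) (B (Suc i))"
  using minimal by (simp add: minimal_projective_resolution_def)

lemma \<epsilon>_Hom: "\<epsilon> \<in> Hom (Q 0) S"
  using minimal by (simp add: minimal_projective_resolution_def)

lemma d_Hom: "d (Suc i) \<in> Hom (Q (Suc i)) (Q i)"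
  using hom_of_matrix_Hom[OF hom_matrix] by (simp add: \<delta>_def)

lemma exact:
  "ker_on (Q 0) \<epsilon> = d (Suc 0) ` carr (Q (Suc 0))"
  "ker_on (Q (Suc i)) (d (Suc i)) = d (Suc (Suc i)) ` carr (Q (Suc (Suc i)))"
  using minimal by (simp_all add: minimal_projective_resolution_def)

sublocale A: projective_resolution "(*)" 1 RA S
proof
  fix i
  show "\<exists>k b c. dual_basis (*) (obj RA i) k b c"
    using dual_basis_Qmod[of "q i" e] idem by (auto simp: res_A_def)
  show "aug RA ` carr (obj RA 0) = carr S"
    using minimal by (simp add: res_A_def minimal_projective_resolution_def)
qed (simp_all add: res_A_def left_module_Qmod \<epsilon>_Hom d_Hom exact)

lemmas Q_module = left_moduleD[OF left_module_Qmod[of e "q i" for i]]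

lemma T_mem: "T (Suc i) x \<in> carr (Q i)"
  by (simp add: T\<delta>_def T_of_matrix_mem)

lemma T_add: "x \<in> carr (Q (Suc i)) \<Longrightarrow> y \<in> carr (Q (Suc i)) \<Longrightarrow> T (Suc i) (x + y) = T (Suc i) x + T (Suc i) y"
  unfolding T\<delta>_def by (rule T_of_matrix_add[OF cocycle]) auto

lemma T_zero: "T (Suc i) 0 = 0"
  using T_add[of 0 i 0] Q_module(1) by simp

lemma T_twisted:
  "x \<in> carr (Q (Suc i)) \<Longrightarrow> T (Suc i) (act (Q (Suc i)) a x) + d (Suc i) (f_Q f e (q (Suc i)) a x)
     = act (Q i) a (T (Suc i) x) + f_Q f e (q i) a (d (Suc i) x)"
  unfolding T\<delta>_def \<delta>_def using T_of_matrix_twisted[OF cocycle hom_matrix idem] by simp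

lemma \<delta>hat_apply:
  assumes "x \<in> carr (Q i)" "y \<in> carr (Q i)"
  shows "even i \<Longrightarrow> \<delta>hat f e q B i (x, y) = (0, d i x)"
    and "odd i \<Longrightarrow> \<delta>hat f e q B i (x, y) = (d i x, T i x + d i y)"
  using assms by (simp_all add: \<delta>hat_def triple_map_def zext_def Qhat_simps)

lemma \<delta>hat_outside: "z \<notin> carr (Qhat f e (q i)) \<Longrightarrow> \<delta>hat f e q B i z = 0"
  by (simp add: \<delta>hat_def triple_map_def zext_def zero_prod_def)

lemma \<delta>hat_Hom: "\<delta>hat f e q B (Suc i) \<in> Hom (Qhat f e (q (Suc i))) (Qhat f e (q i))"
proof (rule HomI)
  note D = HomD[OF d_Hom[of i]]
  have Qa: "act (Q j) = (\<lambda>a x r. a * x r)" for j by (simp add: Qmod_def)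
  have act: "act (Qhat f e (q j)) (a, b) (x, y) = (act (Q j) a x, act (Q j) a y + act (Q j) b x + f_Q f e (q j) a x)"
    for j a b x y by (auto simp: Qhat_simps Qa fun_eq_iff)
  have f0: "f_Q f e (q j) a 0 = 0" for j a using cocycleD(4)[OF cocycle] by (auto simp: f_Q_def)
  fix z assume z: "z \<in> carr (Qhat f e (q (Suc i)))"
  obtain x y where xy [simp]: "z = (x, y)" by (cases z)
  have x: "x \<in> carr (Q (Suc i))" and y: "y \<in> carr (Q (Suc i))" using z by (auto simp: Qhat_simps)
  show "\<delta>hat f e q B (Suc i) z \<in> carr (Qhat f e (q i))"
    using x y D(1) T_mem Q_module(1,3)
    by (cases "even (Suc i)") (auto simp: \<delta>hat_apply Qhat_simps)
  show "\<delta>hat f e q B (Suc i) (z + w) = \<delta>hat f e q B (Suc i) z + \<delta>hat f e q B (Suc i) w"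
    if w: "w \<in> carr (Qhat f e (q (Suc i)))" for w
  proof -
    obtain x' y' where [simp]: "w = (x', y')" by (cases w)
    have "x' \<in> carr (Q (Suc i))" "y' \<in> carr (Q (Suc i))" using w by (auto simp: Qhat_simps)
    then show ?thesis
      using x y D(2) T_add Q_module(3)
      by (cases "even (Suc i)") (simp_all add: \<delta>hat_apply algebra_simps)
  qed
  show "\<delta>hat f e q B (Suc i) (act (Qhat f e (q (Suc i))) c z) = act (Qhat f e (q i)) c (\<delta>hat f e q B (Suc i) z)" for c
  proof -
    obtain a b where [simp]: "c = (a, b)" by (cases c)
    have m: "act (Q (Suc i)) a x \<in> carr (Q (Suc i))" "act (Q (Suc i)) a y \<in> carr (Q (Suc i))"
      "act (Q (Suc i)) b x \<in> carr (Q (Suc i))" "f_Q f e (q (Suc i)) a x \<in> carr (Q (Suc i))"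
      using Q_module(4) x y f_Q_mem by blast+
    show ?thesis
    proof (cases "even (Suc i)")
      case True
      then show ?thesis
        using m x y D(3)[OF x] Q_module(3,5) by (simp add: \<delta>hat_apply act f0)
    next
      case False
      have "act (Q i) a (T (Suc i) x + d (Suc i) y) = act (Q i) a (T (Suc i) x) + act (Q i) a (d (Suc i) y)"
        by (rule left_module_act(1)[OF left_module_Qmod T_mem D(1)[OF y]])
      then show ?thesis
        using False m x y D(2) D(3)[OF x] D(3)[OF y] Q_module(3) T_twisted[OF x, of a]
        by (simp add: \<delta>hat_apply act algebra_simps)
    qed
  qed
qed (rule \<delta>hat_outside)

lemma decomp:
  assumes "even i"
  shows "direct_decomp (carr (Q i)) (T (Suc i) ` ker_on (Q (Suc i)) (d (Suc i))) (d (Suc i) ` carr (Q (Suc i)))"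
proof -
  obtain k where "i = 2 * k" using assms by blast
  then show ?thesis using star by (simp add: star_B_resolution_def)
qed

lemma T_ker_inj:
  assumes "x \<in> ker_on (Q (Suc i)) (d (Suc i))" "even i"
    and "if i = 0 then \<epsilon> (T (Suc i) x) = 0 else d i (T (Suc i) x) = 0"
  shows "x = 0"
proof -
  have 0: "0 \<in> ker_on (Q (Suc i)) (d (Suc i))"
    using Q_module(1) Hom_zero[OF d_Hom] by (simp add: ker_on_def)
  obtain k where k: "i = 2 * k" using assms(2) by blast
  show ?thesis
  proof (cases i)
    case i0: 0
    have "inj_on (\<epsilon> \<circ> T (Suc i)) (ker_on (Q (Suc i)) (d (Suc i)))"
      using star i0 by (simp add: star_B_resolution_def)
    then show ?thesis
      by (rule inj_onD) (use assms 0 i0 T_zero Hom_zero[OF \<epsilon>_Hom] in simp_all)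
  next
    case (Suc j)
    have "inj_on (d i \<circ> T (Suc i)) (ker_on (Q (Suc i)) (d (Suc i)))"
      using star k Suc by (simp add: star_B_resolution_def)
    then show ?thesis
      by (rule inj_onD) (use assms 0 Suc T_zero Hom_zero[OF d_Hom] in simp_all)
  qed
qed

text \<open>
  The decomposition condition at work: a pair \<open>(d x, y)\<close> is a boundary because \<open>y - T x\<close> splits as
  \<open>T k + d y'\<close> with \<open>d k = 0\<close>, so that \<open>(x + k, y')\<close> is a preimage.
\<close>

lemma \<delta>hat_image_even:
  assumes i: "even i"
  shows "\<delta>hat f e q B (Suc i) ` carr (Qhat f e (q (Suc i))) = d (Suc i) ` carr (Q (Suc i)) \<times> carr (Q i)"
proof (intro subset_antisym subsetI)
  note D = HomD[OF d_Hom[of i]]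
  fix z assume "z \<in> d (Suc i) ` carr (Q (Suc i)) \<times> carr (Q i)"
  then obtain x y where z: "z = (d (Suc i) x, y)" and x: "x \<in> carr (Q (Suc i))" and y: "y \<in> carr (Q i)"
    by auto
  have "y - T (Suc i) x \<in> carr (Q i)" by (rule Q_module(2)[OF y T_mem])
  then obtain k y' where k: "k \<in> carr (Q (Suc i))" "d (Suc i) k = 0" and y': "y' \<in> carr (Q (Suc i))"
    and split: "y - T (Suc i) x = T (Suc i) k + d (Suc i) y'"
    using decomp[OF i] unfolding direct_decomp_def ker_on_def by auto
  have "y = T (Suc i) x + (T (Suc i) k + d (Suc i) y')" using split by (simp add: algebra_simps)
  then have "z = \<delta>hat f e q B (Suc i) (x + k, y')"
    using i x k y' Q_module(3)[OF x k(1)] D(2)[OF x k(1)] T_add[OF x k(1)]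
    by (simp add: z \<delta>hat_apply add.assoc)
  then show "z \<in> \<delta>hat f e q B (Suc i) ` carr (Qhat f e (q (Suc i)))"
    using Q_module(3)[OF x k(1)] y' by (auto simp: Qhat_simps)
next
  fix z assume "z \<in> \<delta>hat f e q B (Suc i) ` carr (Qhat f e (q (Suc i)))"
  then show "z \<in> d (Suc i) ` carr (Q (Suc i)) \<times> carr (Q i)"
    using i HomD(1)[OF d_Hom[of i]] T_mem Q_module(3) by (auto simp: Qhat_simps \<delta>hat_apply)
qed

text \<open>
  In odd degree a cycle \<open>(x, y)\<close> satisfies \<open>d x = 0\<close> and \<open>T x = - d y\<close>; then \<open>T x\<close> is a cycle, the
  injectivity condition gives \<open>x = 0\<close>, and \<open>y\<close> is a cycle of the resolution over \<open>A\<close>. In even degree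
  the cycles are exactly the pairs described by \<open>\<delta>hat_image_even\<close>.
\<close>

lemma \<delta>hat_exact:
  "ker_on (Qhat f e (q (Suc i))) (\<delta>hat f e q B (Suc i))
     = \<delta>hat f e q B (Suc (Suc i)) ` carr (Qhat f e (q (Suc (Suc i))))"
proof (cases "even i")
  case False
  have "ker_on (Qhat f e (q (Suc i))) (\<delta>hat f e q B (Suc i)) = ker_on (Q (Suc i)) (d (Suc i)) \<times> carr (Q (Suc i))"
    using False by (auto simp: ker_on_def Qhat_simps \<delta>hat_apply zero_prod_def)
  then show ?thesis using False \<delta>hat_image_even[of "Suc i"] exact(2) by simp
next
  case True
  have dT: "x = 0" if x: "x \<in> carr (Q (Suc i))" "d (Suc i) x = 0" and y: "y \<in> carr (Q (Suc i))"
    and 0: "T (Suc i) x + d (Suc i) y = 0" for x y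
  proof (rule T_ker_inj[OF _ True])
    show "x \<in> ker_on (Q (Suc i)) (d (Suc i))" using x by (simp add: ker_on_def)
    have "T (Suc i) x = 0 - d (Suc i) y" using 0 by (simp add: eq_neg_iff_add_eq_0)
    also have "\<dots> = d (Suc i) (0 - y)"
      using Hom_diff[OF d_Hom left_module_Qmod Q_module(1) y] Hom_zero[OF d_Hom[of i]] by simp
    finally have "T (Suc i) x = d (Suc i) (0 - y)" .
    then show "if i = 0 then \<epsilon> (T (Suc i) x) = 0 else d i (T (Suc i) x) = 0"
      using A.aug_bd A.bd_bd by (cases i) (simp_all add: res_A_def)
  qed
  have "d (Suc i) x = 0 \<and> T (Suc i) x + d (Suc i) y = 0 \<longleftrightarrow> x = 0 \<and> d (Suc i) y = 0"
    if "x \<in> carr (Q (Suc i))" "y \<in> carr (Q (Suc i))" for x y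
    using dT[OF that(1) _ that(2)] T_zero Hom_zero[OF d_Hom[of i]] by auto
  then have "ker_on (Qhat f e (q (Suc i))) (\<delta>hat f e q B (Suc i)) = {0} \<times> ker_on (Q (Suc i)) (d (Suc i))"
    using True Q_module(1) T_zero Hom_zero[OF d_Hom[of i]]
    by (auto simp: ker_on_def Qhat_simps \<delta>hat_apply zero_prod_def)
  moreover have "\<delta>hat f e q B (Suc (Suc i)) ` carr (Qhat f e (q (Suc (Suc i))))
      = {0} \<times> d (Suc (Suc i)) ` carr (Q (Suc (Suc i)))"
    using True Q_module(1) by (force simp: Qhat_simps \<delta>hat_apply image_iff)
  ultimately show ?thesis using exact(2) by simp
qed

sublocale Af: projective_resolution "Af_mult f" "Af_one f" Rf "as_Af_mod S"
proof
  fix i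
  show "left_module (Af_mult f) (Af_one f) (obj Rf i)"
    using left_module_Qhat[OF cocycle, of "q i" e] idem by (simp add: res_Af_def)
  show "\<exists>k b c. dual_basis (Af_mult f) (obj Rf i) k b c"
    using dual_basis_Qhat[OF cocycle, of "q i" e] idem by (auto simp: res_Af_def)
  show "aug Rf \<in> Hom (obj Rf 0) (as_Af_mod S)"
    using hat_in_Hom[OF module_S \<epsilon>_Hom] by (simp add: res_Af_def)
  have "hat f e (q 0) \<epsilon> ` (carr (Q 0) \<times> carr (Q 0)) = {0} \<times> \<epsilon> ` carr (Q 0)"
  proof (intro subset_antisym subsetI)
    fix z :: "'s \<times> 's" assume "z \<in> {0} \<times> \<epsilon> ` carr (Q 0)"
    then obtain x where x: "x \<in> carr (Q 0)" "z = (0, \<epsilon> x)" by auto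
    then have "z = hat f e (q 0) \<epsilon> (x, 0)" by (simp add: hat_apply Q_module(1))
    with x show "z \<in> hat f e (q 0) \<epsilon> ` (carr (Q 0) \<times> carr (Q 0))" using Q_module(1) by blast
  qed (auto simp: hat_apply)
  then show "aug Rf ` carr (obj Rf 0) = carr (as_Af_mod S)"
    using minimal by (simp add: res_Af_def minimal_projective_resolution_def Qhat_simps as_Af_simps)
  have "ker_on (Qhat f e (q 0)) (hat f e (q 0) \<epsilon>) = ker_on (Q 0) \<epsilon> \<times> carr (Q 0)"
    by (auto simp: ker_on_def Qhat_simps hat_apply zero_prod_def)
  then show "ker_on (obj Rf 0) (aug Rf) = bd Rf (Suc 0) ` carr (obj Rf (Suc 0))"
    using \<delta>hat_image_even[of 0] exact(1) by (simp add: res_Af_def)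
qed (simp_all add: res_Af_def \<delta>hat_Hom \<delta>hat_exact)


section \<open>Comparison of the two products\<close>

lemma Ext_A: "Ext RA S p = (\<lambda>g. {g}) ` Hom (Q p) S"
  by (rule ident_bij(1)[OF cocycle simples minimal])

lemma Ext_Af: "Ext Rf (as_Af_mod S) p = (\<lambda>g. {hat f e (q p) g}) ` Hom (Q p) S"
  by (rule ident_bij(2)[OF cocycle simples minimal])

lemma ident_singleton: "g \<in> Hom (Q p) S \<Longrightarrow> ident f e S q B \<epsilon> p {g} = {hat f e (q p) g}"
  by (rule ident_bij(3)[OF cocycle simples minimal])

text \<open>
  By minimality every Ext class, over \<open>A\<close> as over \<open>A\<^sub>f\<close>, has a single representative, so there are
  no nonzero coboundaries.
\<close>

lemma coboundaries_A: "Ext_coboundaries RA S p = {0}"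
  by (rule coboundaries_trivial[OF module_S]) (auto simp: Ext_A)

lemma coboundaries_Af: "Ext_coboundaries Rf (as_Af_mod S) p = {0}"
  by (rule coboundaries_trivial[OF left_module_as_Af[OF cocycle module_S]]) (auto simp: Ext_Af)

lemma Ext_class_A: "Ext_class RA S p g = {g}"
  by (simp add: Ext_class_def coboundaries_A)

lemma Ext_class_Af: "Ext_class Rf (as_Af_mod S) p g = {g}"
  by (simp add: Ext_class_def coboundaries_Af)

lemma Hom_S_bd:
  assumes "h \<in> Hom (Q j) S"
  shows "h \<circ> d (Suc j) = 0"
proof -
  have "h \<circ> d (Suc j) \<in> Ext_coboundaries RA S (Suc j)"
    using assms by (auto simp: Ext_coboundaries_def res_A_def)
  then show ?thesis by (simp add: coboundaries_A)
qed

lemma hat_bd: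
  assumes "g \<in> Hom (Q p) S"
  shows "hat f e (q p) g \<circ> bd Rf (Suc p) = 0"
proof -
  have "hat f e (q p) g \<circ> bd Rf (Suc p) \<in> Ext_coboundaries Rf (as_Af_mod S) (Suc p)"
    using hat_in_Hom[OF module_S assms] by (auto simp: Ext_coboundaries_def res_Af_def)
  then show ?thesis by (simp add: coboundaries_Af)
qed

context
  fixes p :: nat and g :: "(nat \<Rightarrow> 'a) \<Rightarrow> 's"
    and \<gamma> :: "nat \<Rightarrow> (nat \<Rightarrow> 'a) \<times> (nat \<Rightarrow> 'a) \<Rightarrow> (nat \<Rightarrow> 'a) \<times> (nat \<Rightarrow> 'a)"
  assumes g: "g \<in> Hom (Q p) S" and lift: "lifting Rf p (hat f e (q p) g) \<gamma>"
begin

lemma \<gamma>_Hom: "\<gamma> j \<in> Hom (Qhat f e (q (p + j))) (Qhat f e (q j))"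
  using lift by (simp add: lifting_def res_Af_def)

lemmas top_Hom = Hom_Qhat_parts(1)[OF cocycle \<gamma>_Hom]
lemmas \<gamma>_parts = Hom_Qhat_parts(2)[OF cocycle \<gamma>_Hom]
lemmas low_Hom = Hom_Qhat_parts(3)[OF cocycle \<gamma>_Hom]

lemma low_mem: "x \<in> carr (Q (p + j)) \<Longrightarrow> low_part (\<gamma> j) x \<in> carr (Q j)"
  using HomD(1)[OF \<gamma>_Hom, of "(x, 0)" j] Q_module(1) by (auto simp: Qhat_simps low_part_def)

lemma low_zero: "low_part (\<gamma> j) 0 = 0"
  using Hom_zero[OF \<gamma>_Hom, of j] by (simp add: low_part_def zero_prod_def)

text \<open>
  The pairs compare \<open>(\<delta>\<^sub>j\<^sub>+\<^sub>1 \<gamma>\<^sub>j\<^sub>+\<^sub>1)(x, 0)\<close> with \<open>(\<gamma>\<^sub>j \<delta>\<^sub>p\<^sub>+\<^sub>j\<^sub>+\<^sub>1)(x, 0)\<close> for the lifted differentials; the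
  parity on each side is that of its own differential.
\<close>

lemma square:
  assumes x: "x \<in> carr (Q (Suc (p + j)))"
  shows "(if odd j then (0, d (Suc j) (top_part (\<gamma> (Suc j)) x))
      else (d (Suc j) (top_part (\<gamma> (Suc j)) x),
            T (Suc j) (top_part (\<gamma> (Suc j)) x) + d (Suc j) (low_part (\<gamma> (Suc j)) x)))
    = (if odd (p + j) then (0, top_part (\<gamma> j) (d (Suc (p + j)) x))
      else (top_part (\<gamma> j) (d (Suc (p + j)) x),
            low_part (\<gamma> j) (d (Suc (p + j)) x) + top_part (\<gamma> j) (T (Suc (p + j)) x)))"
    (is "?L = ?R")
proof -
  have "\<delta>hat f e q B (Suc j) (\<gamma> (Suc j) (x, 0)) = \<gamma> j (\<delta>hat f e q B (Suc (p + j)) (x, 0))"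
    using lift by (simp add: lifting_def res_Af_def fun_eq_iff)
  moreover have "\<gamma> (Suc j) (x, 0) = (top_part (\<gamma> (Suc j)) x, low_part (\<gamma> (Suc j)) x)"
    by (simp add: top_part_def low_part_def)
  moreover have "\<delta>hat f e q B (Suc j) (top_part (\<gamma> (Suc j)) x, low_part (\<gamma> (Suc j)) x) = ?L"
    using HomD(1)[OF top_Hom, of x "Suc j"] low_mem[of x "Suc j"] x by (simp add: \<delta>hat_apply)
  moreover have "d (Suc (p + j)) x \<in> carr (Q (p + j))" using HomD(1)[OF d_Hom x] .
  then have "\<gamma> j (\<delta>hat f e q B (Suc (p + j)) (x, 0)) = ?R"
    using x Q_module(1) T_mem \<gamma>_parts Hom_zero[OF top_Hom, of j] Hom_zero[OF d_Hom] low_zero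
    by (simp add: \<delta>hat_apply)
  ultimately show ?thesis by simp
qed

lemma aug_top: "\<epsilon> \<circ> top_part (\<gamma> 0) = g"
proof -
  have "hat f e (q p) (\<epsilon> \<circ> top_part (\<gamma> 0)) = hat f e (q p) g"
    using hat_comp[OF cocycle \<gamma>_Hom[of 0] \<epsilon>_Hom module_S] lift by (simp add: lifting_def res_Af_def)
  then show ?thesis
    using inj_onD[OF hat_inj _ Hom_comp[OF top_Hom[of 0] \<epsilon>_Hom]] g by simp
qed

text \<open>
  If \<open>p\<close> and \<open>j + 1\<close> are odd, the square forces \<open>top_part (\<gamma> (Suc j))\<close> to take values in cycles \<open>z\<close> for
  which \<open>T z\<close> is itself a cycle; by the injectivity condition there are no such \<open>z \<noteq> 0\<close>.
\<close>

lemma top_odd_zero: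
  assumes "odd p" "odd j"
  shows "top_part (\<gamma> j) = 0"
  using assms(2)
proof (induction j rule: less_induct)
  case (less j')
  then obtain j where j': "j' = Suc j" and j: "even j" by (cases j') auto
  have "top_part (\<gamma> (Suc j)) x = 0" if x: "x \<in> carr (Q (Suc (p + j)))" for x
  proof (rule T_ker_inj[OF _ j])
    let ?t = "top_part (\<gamma> (Suc j)) x" and ?l = "low_part (\<gamma> (Suc j)) x"
    have t: "?t \<in> carr (Q (Suc j))" and l: "?l \<in> carr (Q (Suc j))"
      using HomD(1)[OF top_Hom, of x "Suc j"] low_mem[of x "Suc j"] x by simp_all
    have dt: "d (Suc j) ?t = 0" and "T (Suc j) ?t + d (Suc j) ?l = top_part (\<gamma> j) (d (Suc (p + j)) x)"
      using square[OF x] j assms(1) by simp_all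
    then have Tt: "T (Suc j) ?t = top_part (\<gamma> j) (d (Suc (p + j)) x) - d (Suc j) ?l"
      by (simp add: algebra_simps)
    show "?t \<in> ker_on (Q (Suc j)) (d (Suc j))" using t dt by (simp add: ker_on_def)
    have mem: "top_part (\<gamma> j) (d (Suc (p + j)) x) \<in> carr (Q j)" "d (Suc j) ?l \<in> carr (Q j)"
      using HomD(1)[OF top_Hom] HomD(1)[OF d_Hom] x l by simp_all
    show "if j = 0 then \<epsilon> (T (Suc j) ?t) = 0 else d j (T (Suc j) ?t) = 0"
    proof (cases j)
      case 0
      have "\<epsilon> (T (Suc 0) ?t) = g (d (Suc p) x) - \<epsilon> (d (Suc 0) ?l)"
        using Hom_diff[OF \<epsilon>_Hom left_module_Qmod] mem fun_cong[OF aug_top] by (simp add: Tt[unfolded 0] 0)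
      also have "\<dots> = 0"
        using fun_cong[OF Hom_S_bd[OF g]] A.aug_bd by (simp add: res_A_def)
      finally show ?thesis by (simp add: 0)
    next
      case (Suc k)
      have IH: "top_part (\<gamma> k) = 0" by (rule less.IH) (use j Suc j' in auto)
      have dx: "d (Suc (p + j)) x \<in> carr (Q (Suc (p + k)))" using HomD(1)[OF d_Hom x] Suc by simp
      have "d j (top_part (\<gamma> j) (d (Suc (p + j)) x)) = low_part (\<gamma> k) (d (Suc (p + k)) (d (Suc (p + j)) x))"
        using square[OF dx] j Suc assms(1) IH by simp
      also have "\<dots> = 0" using A.bd_bd low_zero Suc by (simp add: res_A_def)
      finally have "d j (T (Suc j) ?t) = 0 - d j (d (Suc j) ?l)"
        using Hom_diff[OF d_Hom left_module_Qmod] mem by (simp add: Tt[unfolded Suc] Suc)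
      then show ?thesis using A.bd_bd by (simp add: res_A_def Suc)
    qed
  qed
  then show ?case using HomD(4)[OF top_Hom, of _ j'] by (auto simp: fun_eq_iff j')
qed

text \<open>
  When \<open>p\<close> is odd, the diagonal parts vanish in odd degrees and the off-diagonal parts, which are
  \<open>A\<close>-linear for that reason, take their place.
\<close>

definition restricted_lifting :: "nat \<Rightarrow> (nat \<Rightarrow> 'a) \<Rightarrow> nat \<Rightarrow> 'a" where
  "restricted_lifting j = (if odd p \<and> odd j then low_part (\<gamma> j) else top_part (\<gamma> j))"

lemma restricted_lifting: "lifting RA p g restricted_lifting"
  unfolding lifting_def
proof (intro conjI allI)
  fix j
  show "restricted_lifting j \<in> Hom (obj RA (p + j)) (obj RA j)"
    using top_Hom low_Hom top_odd_zero by (simp add: restricted_lifting_def res_A_def)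
  show "aug RA \<circ> restricted_lifting 0 = g"
    using aug_top by (simp add: restricted_lifting_def res_A_def)
  have "d (Suc j) (restricted_lifting (Suc j) x) = restricted_lifting j (d (Suc (p + j)) x)" for x
  proof (cases "x \<in> carr (Q (Suc (p + j)))")
    case True
    show ?thesis
    proof (cases "odd p")
      case p: True
      show ?thesis
        using square[OF True] p top_odd_zero[OF p, of j] top_odd_zero[OF p, of "Suc j"] T_zero
        by (cases "odd j") (auto simp: restricted_lifting_def)
    next
      case False
      then show ?thesis using square[OF True] by (cases "odd j") (auto simp: restricted_lifting_def)
    qed
  next
    case False
    have z: "d (Suc (p + j)) x = 0" using HomD(4)[OF d_Hom False] .
    have z': "top_part (\<gamma> (Suc j)) x = 0" "low_part (\<gamma> (Suc j)) x = 0"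
      using HomD(4)[OF \<gamma>_Hom[of "Suc j"], of "(x, 0)"] False
      by (simp_all add: Qhat_simps top_part_def low_part_def)
    show ?thesis using z z' low_zero Hom_zero[OF top_Hom] Hom_zero[OF d_Hom]
      by (simp add: restricted_lifting_def)
  qed
  then show "bd RA (Suc j) \<circ> restricted_lifting (Suc j) = restricted_lifting j \<circ> bd RA (p + Suc j)"
    by (simp add: res_A_def fun_eq_iff)
qed

lemma hat_product:
  assumes h: "h \<in> Hom (Q m) S"
  shows "hat f e (q m) h \<circ> \<gamma> m =
    (if odd m \<and> odd p then 0 else hat f e (q (m + p)) (h \<circ> restricted_lifting m))"
proof -
  have "hat f e (q (p + m)) 0 = (0 :: _ \<Rightarrow> 's \<times> 's)"
    by (auto simp: hat_def triple_map_def zext_def zero_prod_def)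
  moreover have "h \<circ> 0 = (0 :: (nat \<Rightarrow> 'a) \<Rightarrow> 's)" using Hom_zero[OF h] by (simp add: fun_eq_iff)
  ultimately show ?thesis
    using hat_comp[OF cocycle \<gamma>_Hom h module_S] top_odd_zero
    by (auto simp: restricted_lifting_def add.commute)
qed

end

lemma yoneda_A:
  assumes "h \<in> Hom (Q m) S" "lifting RA p g \<beta>"
  shows "yoneda RA S m p {h} {g} = {h \<circ> \<beta> m}"
proof -
  have unique: "h \<circ> \<gamma> m = h \<circ> \<beta> m" if "lifting RA p g \<gamma>" for \<gamma>
    using A.lifting_comp_unique[OF that assms(2), of S h m] Hom_S_bd assms(1) by (simp add: res_A_def)
  show ?thesis
  proof (rule yoneda_singleton)
    show "\<exists>\<gamma>. lifting RA p g \<gamma>" using assms(2) by blast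
    show "Ext_class RA S (m + p) (h \<circ> \<gamma> m) = {h \<circ> \<beta> m}" if "lifting RA p g \<gamma>" for \<gamma>
      unfolding Ext_class_A unique[OF that] by (rule refl)
  qed
qed

lemma yoneda_Af:
  assumes g: "g \<in> Hom (Q p) S" and h: "h \<in> Hom (Q m) S"
  shows "yoneda Rf (as_Af_mod S) m p {hat f e (q m) h} {hat f e (q p) g} =
    (if odd m \<and> odd p then {0} else ident f e S q B \<epsilon> (m + p) (yoneda RA S m p {h} {g}))"
    (is "_ = ?Z")
proof -
  have product: "{hat f e (q m) h \<circ> \<gamma> m} = ?Z" if \<gamma>: "lifting Rf p (hat f e (q p) g) \<gamma>" for \<gamma>
  proof -
    note \<beta> = restricted_lifting[OF g \<gamma>]
    have "restricted_lifting p \<gamma> m \<in> Hom (Q (m + p)) (Q m)"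
      using \<beta> by (simp add: lifting_def res_A_def add.commute[of m])
    from Hom_comp[OF this h] have "h \<circ> restricted_lifting p \<gamma> m \<in> Hom (Q (m + p)) S" .
    then show ?thesis
      by (simp add: hat_product[OF g \<gamma> h] yoneda_A[OF h \<beta>] ident_singleton)
  qed
  show ?thesis
  proof (rule yoneda_singleton)
    have "hat f e (q p) g \<in> Hom (obj Rf p) (as_Af_mod S)"
      using hat_in_Hom[OF module_S g] by (simp add: res_Af_def)
    then show "\<exists>\<gamma>. lifting Rf p (hat f e (q p) g) \<gamma>"
      using hat_bd[OF g] by (rule Af.lifting_exists)
    show "Ext_class Rf (as_Af_mod S) (m + p) (hat f e (q m) h \<circ> \<gamma> m) = ?Z"
      if "lifting Rf p (hat f e (q p) g) \<gamma>" for \<gamma>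
      unfolding Ext_class_Af using that by (rule product)
  qed
qed

end

theorem theorem5p4:
  fixes scale :: "'k::alg_closed_field \<Rightarrow> 'a::ring_1 \<Rightarrow> 'a"
    and f :: "'a \<Rightarrow> 'a \<Rightarrow> 'a"
    and n :: nat and e :: "nat \<Rightarrow> 'a"
    and S :: "('a, 's::ab_group_add) lmod"
    and q :: "nat \<Rightarrow> nat list" and B :: "nat \<Rightarrow> nat \<Rightarrow> nat \<Rightarrow> 'a"
    and \<epsilon> :: "(nat \<Rightarrow> 'a) \<Rightarrow> 's"
    and p m :: nat
    and G H :: "((nat \<Rightarrow> 'a) \<Rightarrow> 's) set"
    and Ghat Hhat :: "((nat \<Rightarrow> 'a) \<times> (nat \<Rightarrow> 'a) \<Rightarrow> 's \<times> 's) set"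
  assumes "fd_algebra scale"
    and "hochschild_2cocycle scale f"
    and "basic_idempotents n e"
    and "sum_of_simples n e S"
    and "star_B_resolution f n e S q B \<epsilon>"
    and "Ghat \<in> Ext (res_Af f e q B \<epsilon>) (as_Af_mod S) p"
    and "Hhat \<in> Ext (res_Af f e q B \<epsilon>) (as_Af_mod S) m"
    and "G \<in> Ext (res_A e q B \<epsilon>) S p" and "Ghat = ident f e S q B \<epsilon> p G"
    and "H \<in> Ext (res_A e q B \<epsilon>) S m" and "Hhat = ident f e S q B \<epsilon> m H"
  shows "yoneda (res_Af f e q B \<epsilon>) (as_Af_mod S) m p Hhat Ghat =
    (if odd m \<and> odd p then Ext_class (res_Af f e q B \<epsilon>) (as_Af_mod S) (m + p) 0
     else ident f e S q B \<epsilon> (m + p) (yoneda (res_A e q B \<epsilon>) S m p H G))"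
proof -
  interpret star_B scale f n e S q B \<epsilon>
    by unfold_locales (fact assms)+
  obtain g h where g: "g \<in> Hom (Q p) S" "G = {g}" and h: "h \<in> Hom (Q m) S" "H = {h}"
    using assms(8,10) unfolding Ext_A by blast
  then have "Ghat = {hat f e (q p) g}" "Hhat = {hat f e (q m) h}"
    using assms(9,11) ident_singleton by simp_all
  then show ?thesis
    using yoneda_Af[OF g(1) h(1)] g(2) h(2) by (simp add: Ext_class_Af)
qed

end
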